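(* Let $\mathbf{V}$ be a variety of algebras in a countable language which satisfies the Construction Principle $(\mathrm{CP})$, and let $(\mathcal{K},\preccurlyeq)$ be an $\mathrm{AEC}$-covering of $(\mathcal{F}_{\mathbf{V}},\leq_{\ast}^{\mathrm{ff}})$ admitting a weak independence calculus $(\mathcal{K},\preccurlyeq,\perp)$. If $(\mathcal{K},\preccurlyeq,\perp)$ is nice with respect to free factors, then $(\mathcal{K},\preccurlyeq,\perp)$ is not a superstable independence calculus.
   Context: Free objects. Let $\mathbf{V}$ be a variety of algebras in a language $L$. $\mathcal{F}_{\mathbf{V}}$ is the class of free algebras in $\mathbf{V}$, $\mathcal{F}^{\infty}_{\mathbf{V}}$ (resp. $\mathcal{F}^{<\infty}_{\mathbf{V}}$) the class of those of infinite (resp. finite) rank, and $F_{\mathbf{V}}(m)$ the free algebra of rank $m$. $\ast$ denotes the free product (coproduct) in $\mathbf{V}$, and $B\ast_A C$ the free amalgam (pushout in $\mathbf{V}$) of $B$ and $C$ over $A$. $A\leq B$ means $A$ is an $L$-substructure of $B$; $\langle X\rangle_B$ is the substructure of $B$ generated by $X$. For $A,B\in\mathcal{F}_{\mathbf{V}}$, $A\leq_{\ast}^{\mathrm{ff}}B$ means that there is $C\in\mathcal{F}_{\mathbf{V}}$ with $A\ast C=B$ (i.e., $A,C\leq B$ and $B$ is the internal free product of $A$ and $C$). CP. $\mathbf{V}$ satisfies $(\mathrm{CP})$ if there are countable $A,B\in\mathcal{F}^{\infty}_{\mathbf{V}}$ with $A\leq B$ such that: (a) $A$ is freely generated by $\{a_i:i<\omega\}$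 and, for every $i<\omega$, $\langle a_j:j\leq i\rangle_B\leq_{\ast}^{\mathrm{ff}}B$; (b) $A\not\leq_{\ast}^{\mathrm{ff}}B\ast C$ for every $C\in\mathcal{F}_{\mathbf{V}}$. AECs. A class $\mathcal{K}$ of $L$-structures with a binary relation $\preccurlyeq$ is an abstract elementary class (AEC) if: (1) $\mathcal{K}$ and $\preccurlyeq$ are closed under isomorphism; (2) $A\preccurlyeq B$ implies $A\leq B$; (3) $\preccurlyeq$ is a partial order on $\mathcal{K}$; (4) if $(A_i)_{i<\delta}$ is an increasing continuous $\preccurlyeq$-chain in $\mathcal{K}$, then $\bigcup_{i<\delta}A_i\in\mathcal{K}$, $A_j\preccurlyeq\bigcup_{i<\delta}A_i$ for each $j<\delta$, and if $A_i\preccurlyeq B$ for all $i<\delta$ then $\bigcup_{i<\delta}A_i\preccurlyeq B$; (5) if $A,B,C\in\mathcal{K}$, $A\preccurlyeq C$, $B\preccurlyeq C$ and $A\leq B$, then $A\preccurlyeq B$; (6) there is a cardinal $\mathrm{LS}(\mathcal{K},\preccurlyeq)\geq|L|+\aleph_0$ such that if $A\in\mathcal{K}$ and $B\subseteq A$, there is $C\in\mathcal{K}$ with $B\subseteq C\preccurlyeq A$ and $|C|\leq|B|+\mathrm{LS}(\mathcal{K},\preccurlyeq)$. An embedding $f:A\to B$ is strong if $f(A)\preccurlyeq B$. AP and JEP are amalgamation and joint embedding with respect to strong embeddings. AEC-covering. $(\mathcal{K},\preccurlyeq)$ is an $\mathrm{AEC}$-covering of $(\mathcal{F}_{\mathbf{V}},\leq_{\ast}^{\mathrm{ff}})$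 if: $\mathcal{F}^{\infty}_{\mathbf{V}}\subseteq\mathcal{K}$; $(\mathcal{K},\preccurlyeq)$ is an AEC; for $A,B\in\mathcal{F}_{\mathbf{V}}\cap\mathcal{K}$, $A\leq_{\ast}^{\mathrm{ff}}B$ implies $A\preccurlyeq B$; and $(\mathcal{K},\preccurlyeq)$ has AP and JEP. Monster model and types. $\mathfrak{M}\in\mathcal{K}$ is the monster model: for some large enough $\kappa$, every $C\in\mathcal{K}$ with $|C|\leq\kappa$ strongly embeds in $\mathfrak{M}$, and every isomorphism between strong substructures of $\mathfrak{M}$ of size $<\kappa$ extends to an automorphism of $\mathfrak{M}$. The strong submodels considered have size $<\kappa$. The (Galois) type $\mathrm{tp}(\bar a/A)$ is the orbit of the tuple $\bar a$ under the automorphisms of $\mathfrak{M}$ fixing $A$ pointwise; $S(B)$ is the set of types over $B$. Weak independence calculus. $(\mathcal{K},\preccurlyeq,\perp)$ is a weak independence calculus if $\perp$ is a ternary relation, written $\bar a\perp_{A_0}A_1$, between tuples $\bar a\in\mathfrak{M}^{<\omega}$ and strong submodels $A_0,A_1$ of $\mathfrak{M}$, satisfying: (i) Invariance: if $\bar a\perp_{A_0}A_1$ and $f\in\mathrm{Aut}(\mathfrak{M})$, then $f(\bar a)\perp_{f(A_0)}f(A_1)$. (ii) Disjointness: if $\bar a\perp_{A_0}A_1$, then $\bar a\in A_1$ if and only if $\bar a\in A_0$. (iii) Symmetry: if $A_0\preccurlyeq A_1\preccurlyeq\mathfrak{M}$, $\bar b\perp_{A_0}A_1$ and $\bar a\in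 A_1^{<\omega}$, then there is $A_2$ with $A_0\preccurlyeq A_2$, $\bar b\in A_2^{<\omega}$ and $\bar a\perp_{A_0}A_2$. (iv) Monotonicity: if $A\preccurlyeq A'\preccurlyeq B'\preccurlyeq B\preccurlyeq\mathfrak{M}$ and $\bar a\perp_A B$, then $\bar a\perp_{A'}B'$. (v) Existence: if $A\preccurlyeq B\preccurlyeq\mathfrak{M}$ and $\bar a\in\mathfrak{M}^{<\omega}$, there is $q\in S(B)$ with $q\restriction A=\mathrm{tp}(\bar a/A)$ and such that $\bar b\perp_A B$ for some $\bar b\models q$. (vi) Uniqueness: if $A\preccurlyeq B\preccurlyeq\mathfrak{M}$, $\bar a\perp_A B$, $\bar b\perp_A B$ and $\mathrm{tp}(\bar a/A)=\mathrm{tp}(\bar b/A)$, then $\mathrm{tp}(\bar a/B)=\mathrm{tp}(\bar b/B)$. (vii) Continuity: if $\delta$ is a limit ordinal, $(A_i)_{i\leq\delta}$ is a continuous $\preccurlyeq$-chain, $A_\delta\preccurlyeq\mathfrak{M}$, and $\bar a,(\bar a_i)_{i<\delta}$ satisfy $\bar a_i\perp_{A_0}A_i$ and $\mathrm{tp}(\bar a_i/A_i)=\mathrm{tp}(\bar a/A_i)$ for all $i<\delta$, then $\bar a\perp_{A_0}A_\delta$. It is a superstable independence calculus if in addition: (viii) Superstable Local Character: if $\delta$ is a limit ordinal, $(A_i)_{i\leq\delta}$ is an increasing continuous $\preccurlyeq$-chain, $A_\delta\preccurlyeq\mathfrak{M}$ and $\bar a\in\mathfrak{M}^{<\omega}$,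 then there is $\alpha<\delta$ with $\bar a\perp_{A_\alpha}A_\delta$. For a set $B\subseteq\mathfrak{M}$, $B\perp_A C$ means $\bar b\perp_A C$ for every finite tuple $\bar b$ from $B$. Free independence. For $A,B,C\in\mathcal{F}_{\mathbf{V}}$ with $A,B,C\preccurlyeq\mathfrak{M}$ and $A\leq_{\ast}^{\mathrm{ff}}B$, $A\leq_{\ast}^{\mathrm{ff}}C$, write $B\perp^{\ast}_A C$ if $B\ast_A C=\langle BC\rangle_{\mathfrak{M}}\preccurlyeq\mathfrak{M}$. Nice with respect to free factors. $(\mathcal{K},\preccurlyeq,\perp)$ is nice with respect to free factors if: $(\star_1)$ there is $n_*<\omega$ such that $F_{\mathbf{V}}(m)\in\mathcal{K}$ for every $n_*\leq m<\omega$; $(\star_2)$ there is $m_*<\omega$ such that, if $A,B,C\in\mathcal{F}_{\mathbf{V}}$ with $A,B,C\preccurlyeq\mathfrak{M}$, $A\leq_{\ast}^{\mathrm{ff}}B$, $A\leq_{\ast}^{\mathrm{ff}}C$ and $A$ has rank at least $m_*$, then $B\perp_A C$ if and only if $B\perp^{\ast}_A C$; $(\star_3)$ if $A\in\mathcal{F}^{<\infty}_{\mathbf{V}}\cap\mathcal{K}$, $B,C\in\mathcal{F}_{\mathbf{V}}\cap\mathcal{K}$ with $A,B,C\preccurlyeq\mathfrak{M}$ and $A\leq_{\ast}^{\mathrm{ff}}C$, then for every $c\in C$ with $c\perp_A B$ there is $D\in\mathcal{F}^{<\infty}_{\mathbf{V}}$ such that $c\in D$, $A\leq_{\ast}^{\mathrm{ff}}D\leq_{\ast}^{\mathrm{ff}}C$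 and $D\perp_A B$; $(\star_4)$ if $A,B,C\in\mathcal{F}^{<\infty}_{\mathbf{V}}\cap\mathcal{K}$, $D\in\mathcal{F}_{\mathbf{V}}\cap\mathcal{K}$ with $A,B,C,D\preccurlyeq\mathfrak{M}$, $A\leq_{\ast}^{\mathrm{ff}}B\leq_{\ast}^{\mathrm{ff}}D$, $A\leq_{\ast}^{\mathrm{ff}}C\leq_{\ast}^{\mathrm{ff}}D$ and $B\perp_A C$, then $B\ast_A C\leq_{\ast}^{\mathrm{ff}}D$. *)

theory Defs
  imports "HOL-Library.FuncSet" "HOL-Library.Countable_Set"
begin

unbundle cardinal_syntax

text \<open>
  HOL has no proper classes.  All structures have their carriers inside an arbitrary type
  \<^typ>\<open>'a\<close>, and a class of structures is a set of structures over that type.  Cardinals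
  and ordinals are represented by well-orders on \<^typ>\<open>'a\<close>.  This loses nothing: as soon
  as \<^typ>\<open>'a\<close> is infinite and the language is countable, free algebras, free products and
  free amalgams of algebras over \<^typ>\<open>'a\<close> have copies over \<^typ>\<open>'a\<close>; and
  a strictly increasing well-ordered chain of subsets of \<^typ>\<open>'a\<close> has an order type that
  is realised on \<^typ>\<open>'a\<close>.
\<close>

section \<open>Algebras\<close>

text \<open>A language maps each of its function symbols to the arity; \<^term>\<open>dom L\<close> is its set
  of symbols.\<close>

type_synonym 'f language = "'f \<Rightarrow> nat option"

record ('f, 'a) algebra =
  carrier :: "'a set"
  interp :: "'f \<Rightarrow> 'a list \<Rightarrow> 'a"

definition args :: "'f language \<Rightarrow> 'a set \<Rightarrow> 'f \<Rightarrow> 'a list \<Rightarrow> bool" where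
  "args L S f xs \<longleftrightarrow> L f = Some (length xs) \<and> set xs \<subseteq> S"

text \<open>Operations are \<^const>\<open>undefined\<close> outside their domain, so that equality of algebras
  is equality of structures.  The empty algebra is admitted (if there are no constants); it is then
  the free algebra of rank 0, the unit for the free product.\<close>

definition alg :: "'f language \<Rightarrow> ('f, 'a) algebra \<Rightarrow> bool" where
  "alg L A \<longleftrightarrow>
     (\<forall>f xs. args L (carrier A) f xs \<longrightarrow> interp A f xs \<in> carrier A) \<and>
     (\<forall>f xs. \<not> args L (carrier A) f xs \<longrightarrow> interp A f xs = undefined)"

definition substr :: "'f language \<Rightarrow> ('f, 'a) algebra \<Rightarrow> ('f, 'a) algebra \<Rightarrow> bool" where
  "substr L A B \<longleftrightarrow> alg L A \<and> alg L B \<and> carrier A \<subseteq> carrier B \<and>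
     (\<forall>f xs. args L (carrier A) f xs \<longrightarrow> interp A f xs = interp B f xs)"

definition induced :: "'f language \<Rightarrow> ('f, 'a) algebra \<Rightarrow> 'a set \<Rightarrow> ('f, 'a) algebra" where
  "induced L B S =
     \<lparr>carrier = S, interp = (\<lambda>f xs. if args L S f xs then interp B f xs else undefined)\<rparr>"

definition gen :: "'f language \<Rightarrow> ('f, 'a) algebra \<Rightarrow> 'a set \<Rightarrow> ('f, 'a) algebra" where
  "gen L B X = induced L B (\<Inter>{carrier A | A. substr L A B \<and> X \<subseteq> carrier A})"

definition hom :: "'f language \<Rightarrow> ('a \<Rightarrow> 'a) \<Rightarrow> ('f, 'a) algebra \<Rightarrow> ('f, 'a) algebra \<Rightarrow> bool" where
  "hom L h A B \<longleftrightarrow> alg L A \<and> alg L B \<and> h \<in> carrier A \<rightarrow> carrier B \<and>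
     (\<forall>f xs. args L (carrier A) f xs \<longrightarrow> h (interp A f xs) = interp B f (map h xs))"

definition emb :: "'f language \<Rightarrow> ('a \<Rightarrow> 'a) \<Rightarrow> ('f, 'a) algebra \<Rightarrow> ('f, 'a) algebra \<Rightarrow> bool" where
  "emb L h A B \<longleftrightarrow> hom L h A B \<and> inj_on h (carrier A)"

definition iso :: "'f language \<Rightarrow> ('a \<Rightarrow> 'a) \<Rightarrow> ('f, 'a) algebra \<Rightarrow> ('f, 'a) algebra \<Rightarrow> bool" where
  "iso L h A B \<longleftrightarrow> hom L h A B \<and> bij_betw h (carrier A) (carrier B)"

text \<open>The image \<open>h(A)\<close>, for \<open>A\<close> a subalgebra of the domain of a
  homomorphism \<open>h\<close> into \<open>B\<close>.\<close>

abbreviation img :: "'f language \<Rightarrow> ('f, 'a) algebra \<Rightarrow> ('a \<Rightarrow> 'a) \<Rightarrow> ('f, 'a) algebra \<Rightarrow> ('f, 'a) algebra" where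
  "img L B h A \<equiv> induced L B (h ` carrier A)"


section \<open>Varieties and free algebras\<close>

datatype 'f trm = Var nat | App 'f "'f trm list"

fun wf_trm :: "'f language \<Rightarrow> 'f trm \<Rightarrow> bool" where
  "wf_trm L (Var n) \<longleftrightarrow> True"
| "wf_trm L (App f ts) \<longleftrightarrow> L f = Some (length ts) \<and> (\<forall>t \<in> set ts. wf_trm L t)"

fun trm_val :: "('f, 'a) algebra \<Rightarrow> (nat \<Rightarrow> 'a) \<Rightarrow> 'f trm \<Rightarrow> 'a" where
  "trm_val A v (Var n) = v n"
| "trm_val A v (App f ts) = interp A f (map (trm_val A v) ts)"

definition variety :: "'f language \<Rightarrow> ('f, 'a) algebra set \<Rightarrow> bool" where
  "variety L V \<longleftrightarrow>
     (\<exists>E. (\<forall>(s, t) \<in> E. wf_trm L s \<and> wf_trm L t) \<and>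
          V = {A. alg L A \<and>
                  (\<forall>(s, t) \<in> E. \<forall>v. range v \<subseteq> carrier A \<longrightarrow> trm_val A v s = trm_val A v t)})"

definition free_on :: "'f language \<Rightarrow> ('f, 'a) algebra set \<Rightarrow> ('f, 'a) algebra \<Rightarrow> 'a set \<Rightarrow> bool" where
  "free_on L V A X \<longleftrightarrow> A \<in> V \<and> X \<subseteq> carrier A \<and> gen L A X = A \<and>
     (\<forall>D \<in> V. \<forall>\<phi> \<in> X \<rightarrow> carrier D. \<exists>h. hom L h A D \<and> (\<forall>x \<in> X. h x = \<phi> x))"

text \<open>Free bases of one and the same algebra may have different finite cardinalities in some
  varieties, so an algebra may have several finite ranks.\<close>

definition free_algs :: "'f language \<Rightarrow> ('f, 'a) algebra set \<Rightarrow> ('f, 'a) algebra set" where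
  "free_algs L V = {A. \<exists>X. free_on L V A X}"

definition free_inf :: "'f language \<Rightarrow> ('f, 'a) algebra set \<Rightarrow> ('f, 'a) algebra set" where
  "free_inf L V = {A. \<exists>X. free_on L V A X \<and> infinite X}"

definition free_fin :: "'f language \<Rightarrow> ('f, 'a) algebra set \<Rightarrow> ('f, 'a) algebra set" where
  "free_fin L V = {A. \<exists>X. free_on L V A X \<and> finite X}"

definition free_of_rank :: "'f language \<Rightarrow> ('f, 'a) algebra set \<Rightarrow> nat \<Rightarrow> ('f, 'a) algebra set" where
  "free_of_rank L V m = {A. \<exists>X. free_on L V A X \<and> finite X \<and> card X = m}"

definition rank_at_least :: "'f language \<Rightarrow> ('f, 'a) algebra set \<Rightarrow> nat \<Rightarrow> ('f, 'a) algebra \<Rightarrow> bool" where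
  "rank_at_least L V m A \<longleftrightarrow> (\<exists>X. free_on L V A X \<and> (infinite X \<or> m \<le> card X))"

text \<open>\<open>P\<close> is the free product of \<open>B\<close> and \<open>C\<close> with
  coprojections \<open>i\<close> and \<open>j\<close>.\<close>

definition coproduct :: "'f language \<Rightarrow> ('f, 'a) algebra set \<Rightarrow> ('f, 'a) algebra \<Rightarrow> ('a \<Rightarrow> 'a) \<Rightarrow>
    ('f, 'a) algebra \<Rightarrow> ('a \<Rightarrow> 'a) \<Rightarrow> ('f, 'a) algebra \<Rightarrow> bool" where
  "coproduct L V B i C j P \<longleftrightarrow> B \<in> V \<and> C \<in> V \<and> P \<in> V \<and> hom L i B P \<and> hom L j C P \<and>
     (\<forall>D \<in> V. \<forall>f g. hom L f B D \<and> hom L g C D \<longrightarrow>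
        (\<exists>h. hom L h P D \<and> (\<forall>x \<in> carrier B. h (i x) = f x) \<and> (\<forall>x \<in> carrier C. h (j x) = g x) \<and>
           (\<forall>h'. hom L h' P D \<and> (\<forall>x \<in> carrier B. h' (i x) = f x) \<and> (\<forall>x \<in> carrier C. h' (j x) = g x)
              \<longrightarrow> (\<forall>x \<in> carrier P. h' x = h x))))"

definition free_product :: "'f language \<Rightarrow> ('f, 'a) algebra set \<Rightarrow> ('f, 'a) algebra \<Rightarrow>
    ('f, 'a) algebra \<Rightarrow> ('f, 'a) algebra \<Rightarrow> bool" where
  "free_product L V A C B \<longleftrightarrow> substr L A B \<and> substr L C B \<and> coproduct L V A id C id B"

text \<open>\<open>P\<close> is the internal free amalgam of its subalgebras \<open>B\<close> and
  \<open>C\<close> over their common subalgebra \<open>A\<close>.\<close>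

definition free_amalgam :: "'f language \<Rightarrow> ('f, 'a) algebra set \<Rightarrow> ('f, 'a) algebra \<Rightarrow>
    ('f, 'a) algebra \<Rightarrow> ('f, 'a) algebra \<Rightarrow> ('f, 'a) algebra \<Rightarrow> bool" where
  "free_amalgam L V A B C P \<longleftrightarrow>
     A \<in> V \<and> B \<in> V \<and> C \<in> V \<and> P \<in> V \<and>
     substr L A B \<and> substr L A C \<and> substr L B P \<and> substr L C P \<and>
     (\<forall>D \<in> V. \<forall>f g. hom L f B D \<and> hom L g C D \<and> (\<forall>x \<in> carrier A. f x = g x) \<longrightarrow>
        (\<exists>h. hom L h P D \<and> (\<forall>x \<in> carrier B. h x = f x) \<and> (\<forall>x \<in> carrier C. h x = g x) \<and>
           (\<forall>h'. hom L h' P D \<and> (\<forall>x \<in> carrier B. h' x = f x) \<and> (\<forall>x \<in> carrier C. h' x = g x)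
              \<longrightarrow> (\<forall>x \<in> carrier P. h' x = h x))))"

definition ff :: "'f language \<Rightarrow> ('f, 'a) algebra set \<Rightarrow> ('f, 'a) algebra \<Rightarrow> ('f, 'a) algebra \<Rightarrow> bool" where
  "ff L V A B \<longleftrightarrow> A \<in> free_algs L V \<and> B \<in> free_algs L V \<and>
     (\<exists>C \<in> free_algs L V. free_product L V A C B)"

text \<open>The free product of \<open>B\<close> and \<open>C\<close> is only determined up to
  isomorphism, so \<open>A\<close> is regarded as a subalgebra of it through the coprojection of
  \<open>B\<close>.\<close>

definition construction_principle :: "'f language \<Rightarrow> ('f, 'a) algebra set \<Rightarrow> bool" where
  "construction_principle L V \<longleftrightarrow>
     (\<exists>A \<in> free_inf L V. \<exists>B \<in> free_inf L V.
        countable (carrier A) \<and> countable (carrier B) \<and> substr L A B \<and>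
        (\<exists>a :: nat \<Rightarrow> 'a. inj a \<and> free_on L V A (range a) \<and>
           (\<forall>i. ff L V (gen L B (a ` {..i})) B)) \<and>
        (\<forall>C \<in> free_algs L V. \<forall>P i j. coproduct L V B i C j P \<longrightarrow> \<not> ff L V (img L P i A) P))"


section \<open>Abstract elementary classes\<close>

text \<open>\<open>S\<close> is an initial segment of \<open>r\<close> whose order type is a limit
  ordinal.\<close>

definition limit_seg :: "'a rel \<Rightarrow> 'a set \<Rightarrow> bool" where
  "limit_seg r S \<longleftrightarrow> S \<noteq> {} \<and> (\<forall>j \<in> S. \<exists>k \<in> S. j \<noteq> k \<and> (j, k) \<in> r)"

definition is_union :: "'f language \<Rightarrow> 'a set \<Rightarrow> ('a \<Rightarrow> ('f, 'a) algebra) \<Rightarrow> ('f, 'a) algebra \<Rightarrow> bool" where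
  "is_union L I A U \<longleftrightarrow> alg L U \<and> carrier U = (\<Union>i \<in> I. carrier (A i)) \<and> (\<forall>i \<in> I. substr L (A i) U)"

text \<open>The well-order \<open>r\<close> stands for the ordinal \<open>\<delta>\<close>, and
  \<^term>\<open>Field r\<close> for the set of ordinals below \<open>\<delta>\<close>.  A chain
  indexed by the ordinals up to and including a limit \<open>\<delta>\<close> is a chain below
  \<open>\<delta>\<close> together with its union.\<close>

definition cont_chain :: "'f language \<Rightarrow> ('f, 'a) algebra set \<Rightarrow>
    (('f, 'a) algebra \<Rightarrow> ('f, 'a) algebra \<Rightarrow> bool) \<Rightarrow> 'a rel \<Rightarrow> ('a \<Rightarrow> ('f, 'a) algebra) \<Rightarrow> bool" where
  "cont_chain L K le r A \<longleftrightarrow> Well_order r \<and> Field r \<noteq> {} \<and>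
     (\<forall>i \<in> Field r. A i \<in> K) \<and>
     (\<forall>i j. (i, j) \<in> r \<longrightarrow> le (A i) (A j)) \<and>
     (\<forall>i \<in> Field r. limit_seg r (underS r i) \<longrightarrow> is_union L (underS r i) A (A i))"

definition LS_cardinal :: "'f language \<Rightarrow> ('f, 'a) algebra set \<Rightarrow>
    (('f, 'a) algebra \<Rightarrow> ('f, 'a) algebra \<Rightarrow> bool) \<Rightarrow> 'a rel \<Rightarrow> bool" where
  "LS_cardinal L K le \<mu> \<longleftrightarrow> Card_order \<mu> \<and> |dom L| +c natLeq \<le>o \<mu> \<and>
     (\<forall>A \<in> K. \<forall>B. B \<subseteq> carrier A \<longrightarrow>
        (\<exists>C \<in> K. B \<subseteq> carrier C \<and> le C A \<and> |carrier C| \<le>o |B| +c \<mu>))"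

definition AEC :: "'f language \<Rightarrow> ('f, 'a) algebra set \<Rightarrow>
    (('f, 'a) algebra \<Rightarrow> ('f, 'a) algebra \<Rightarrow> bool) \<Rightarrow> bool" where
  "AEC L K le \<longleftrightarrow>
     (\<forall>A \<in> K. alg L A) \<and>
     (\<forall>A B. le A B \<longrightarrow> A \<in> K \<and> B \<in> K) \<and>
     (\<forall>A B h. A \<in> K \<and> iso L h A B \<longrightarrow> B \<in> K) \<and>
     (\<forall>A B B' h. le A B \<and> iso L h B B' \<longrightarrow> le (img L B' h A) B') \<and>
     (\<forall>A B. le A B \<longrightarrow> substr L A B) \<and>
     (\<forall>A \<in> K. le A A) \<and>
     (\<forall>A B. le A B \<and> le B A \<longrightarrow> A = B) \<and>
     (\<forall>A B C. le A B \<and> le B C \<longrightarrow> le A C) \<and>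
     (\<forall>r A U. cont_chain L K le r A \<and> is_union L (Field r) A U \<longrightarrow>
        U \<in> K \<and> (\<forall>j \<in> Field r. le (A j) U) \<and>
        (\<forall>B \<in> K. (\<forall>i \<in> Field r. le (A i) B) \<longrightarrow> le U B)) \<and>
     (\<forall>A B C. le A C \<and> le B C \<and> substr L A B \<longrightarrow> le A B) \<and>
     (\<exists>\<mu>. LS_cardinal L K le \<mu>)"

definition strong_emb :: "'f language \<Rightarrow> (('f, 'a) algebra \<Rightarrow> ('f, 'a) algebra \<Rightarrow> bool) \<Rightarrow>
    ('a \<Rightarrow> 'a) \<Rightarrow> ('f, 'a) algebra \<Rightarrow> ('f, 'a) algebra \<Rightarrow> bool" where
  "strong_emb L le h A B \<longleftrightarrow> emb L h A B \<and> le (img L B h A) B"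

definition AP :: "'f language \<Rightarrow> ('f, 'a) algebra set \<Rightarrow>
    (('f, 'a) algebra \<Rightarrow> ('f, 'a) algebra \<Rightarrow> bool) \<Rightarrow> bool" where
  "AP L K le \<longleftrightarrow>
     (\<forall>A \<in> K. \<forall>B \<in> K. \<forall>C \<in> K. \<forall>f g. strong_emb L le f A B \<and> strong_emb L le g A C \<longrightarrow>
        (\<exists>D \<in> K. \<exists>f' g'. strong_emb L le f' B D \<and> strong_emb L le g' C D \<and>
           (\<forall>x \<in> carrier A. f' (f x) = g' (g x))))"

definition JEP :: "'f language \<Rightarrow> ('f, 'a) algebra set \<Rightarrow>
    (('f, 'a) algebra \<Rightarrow> ('f, 'a) algebra \<Rightarrow> bool) \<Rightarrow> bool" where
  "JEP L K le \<longleftrightarrow>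
     (\<forall>B \<in> K. \<forall>C \<in> K. \<exists>D \<in> K. \<exists>f g. strong_emb L le f B D \<and> strong_emb L le g C D)"

definition AEC_covering :: "'f language \<Rightarrow> ('f, 'a) algebra set \<Rightarrow> ('f, 'a) algebra set \<Rightarrow>
    (('f, 'a) algebra \<Rightarrow> ('f, 'a) algebra \<Rightarrow> bool) \<Rightarrow> bool" where
  "AEC_covering L V K le \<longleftrightarrow>
     free_inf L V \<subseteq> K \<and> AEC L K le \<and>
     (\<forall>A \<in> free_algs L V \<inter> K. \<forall>B \<in> free_algs L V \<inter> K. ff L V A B \<longrightarrow> le A B) \<and>
     AP L K le \<and> JEP L K le"


section \<open>Monster model, types and independence\<close>

text \<open>That \<open>\<kappa>\<close> is large enough means that it is above a
  Loewenheim-Skolem number of the class.\<close>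

definition monster :: "'f language \<Rightarrow> ('f, 'a) algebra set \<Rightarrow>
    (('f, 'a) algebra \<Rightarrow> ('f, 'a) algebra \<Rightarrow> bool) \<Rightarrow> 'a rel \<Rightarrow> ('f, 'a) algebra \<Rightarrow> bool" where
  "monster L K le \<kappa> M \<longleftrightarrow> M \<in> K \<and> Card_order \<kappa> \<and> (\<exists>\<mu>. LS_cardinal L K le \<mu> \<and> \<mu> <o \<kappa>) \<and>
     (\<forall>C \<in> K. |carrier C| \<le>o \<kappa> \<longrightarrow> (\<exists>h. strong_emb L le h C M)) \<and>
     (\<forall>A B h. le A M \<and> le B M \<and> |carrier A| <o \<kappa> \<and> |carrier B| <o \<kappa> \<and> iso L h A B \<longrightarrow>
        (\<exists>F. iso L F M M \<and> (\<forall>x \<in> carrier A. F x = h x)))"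

definition small_strong :: "(('f, 'a) algebra \<Rightarrow> ('f, 'a) algebra \<Rightarrow> bool) \<Rightarrow> 'a rel \<Rightarrow>
    ('f, 'a) algebra \<Rightarrow> ('f, 'a) algebra \<Rightarrow> bool" where
  "small_strong le \<kappa> M A \<longleftrightarrow> le A M \<and> |carrier A| <o \<kappa>"

definition tp :: "'f language \<Rightarrow> ('f, 'a) algebra \<Rightarrow> 'a list \<Rightarrow> ('f, 'a) algebra \<Rightarrow> 'a list set" where
  "tp L M a A = {map F a | F. iso L F M M \<and> (\<forall>x \<in> carrier A. F x = x)}"

definition types_over :: "'f language \<Rightarrow> ('f, 'a) algebra \<Rightarrow> ('f, 'a) algebra \<Rightarrow> 'a list set set" where
  "types_over L M B = {tp L M b B | b. set b \<subseteq> carrier M}"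

definition tp_restrict :: "'f language \<Rightarrow> ('f, 'a) algebra \<Rightarrow> 'a list set \<Rightarrow> ('f, 'a) algebra \<Rightarrow> 'a list set" where
  "tp_restrict L M q A = (\<Union>b \<in> q. tp L M b A)"

text \<open>Here \<^term>\<open>ind a A\<^sub>0 A\<^sub>1\<close> says that the tuple \<open>a\<close> is
  independent from \<open>A\<^sub>1\<close> over \<open>A\<^sub>0\<close>.\<close>

definition ind_typed :: "(('f, 'a) algebra \<Rightarrow> ('f, 'a) algebra \<Rightarrow> bool) \<Rightarrow>
    'a rel \<Rightarrow>
    ('f, 'a) algebra \<Rightarrow>
    ('a list \<Rightarrow> ('f, 'a) algebra \<Rightarrow> ('f, 'a) algebra \<Rightarrow> bool) \<Rightarrow> bool" where
  "ind_typed le \<kappa> M ind \<longleftrightarrow>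
     (\<forall>a A\<^sub>0 A\<^sub>1. ind a A\<^sub>0 A\<^sub>1 \<longrightarrow>
        set a \<subseteq> carrier M \<and> small_strong le \<kappa> M A\<^sub>0 \<and> small_strong le \<kappa> M A\<^sub>1)"

definition invariance :: "'f language \<Rightarrow>
    ('f, 'a) algebra \<Rightarrow>
    ('a list \<Rightarrow> ('f, 'a) algebra \<Rightarrow> ('f, 'a) algebra \<Rightarrow> bool) \<Rightarrow> bool" where
  "invariance L M ind \<longleftrightarrow>
     (\<forall>a A\<^sub>0 A\<^sub>1 F. ind a A\<^sub>0 A\<^sub>1 \<and> iso L F M M \<longrightarrow>
        ind (map F a) (img L M F A\<^sub>0) (img L M F A\<^sub>1))"

definition disjointness :: "('a list \<Rightarrow> ('f, 'a) algebra \<Rightarrow> ('f, 'a) algebra \<Rightarrow> bool) \<Rightarrow> bool" where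
  "disjointness ind \<longleftrightarrow>
     (\<forall>a A\<^sub>0 A\<^sub>1. ind a A\<^sub>0 A\<^sub>1 \<longrightarrow> (set a \<subseteq> carrier A\<^sub>1 \<longleftrightarrow> set a \<subseteq> carrier A\<^sub>0))"

definition symmetry :: "(('f, 'a) algebra \<Rightarrow> ('f, 'a) algebra \<Rightarrow> bool) \<Rightarrow>
    'a rel \<Rightarrow>
    ('f, 'a) algebra \<Rightarrow>
    ('a list \<Rightarrow> ('f, 'a) algebra \<Rightarrow> ('f, 'a) algebra \<Rightarrow> bool) \<Rightarrow> bool" where
  "symmetry le \<kappa> M ind \<longleftrightarrow>
     (\<forall>a b A\<^sub>0 A\<^sub>1. le A\<^sub>0 A\<^sub>1 \<and> small_strong le \<kappa> M A\<^sub>1 \<and> ind b A\<^sub>0 A\<^sub>1 \<and> set a \<subseteq> carrier A\<^sub>1 \<longrightarrow>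
        (\<exists>A\<^sub>2. le A\<^sub>0 A\<^sub>2 \<and> set b \<subseteq> carrier A\<^sub>2 \<and> ind a A\<^sub>0 A\<^sub>2))"

definition monotonicity :: "(('f, 'a) algebra \<Rightarrow> ('f, 'a) algebra \<Rightarrow> bool) \<Rightarrow>
    'a rel \<Rightarrow>
    ('f, 'a) algebra \<Rightarrow>
    ('a list \<Rightarrow> ('f, 'a) algebra \<Rightarrow> ('f, 'a) algebra \<Rightarrow> bool) \<Rightarrow> bool" where
  "monotonicity le \<kappa> M ind \<longleftrightarrow>
     (\<forall>a A A' B' B. le A A' \<and> le A' B' \<and> le B' B \<and> small_strong le \<kappa> M B \<and> ind a A B \<longrightarrow>
        ind a A' B')"

definition existence :: "'f language \<Rightarrow>
    (('f, 'a) algebra \<Rightarrow> ('f, 'a) algebra \<Rightarrow> bool) \<Rightarrow>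
    'a rel \<Rightarrow>
    ('f, 'a) algebra \<Rightarrow>
    ('a list \<Rightarrow> ('f, 'a) algebra \<Rightarrow> ('f, 'a) algebra \<Rightarrow> bool) \<Rightarrow> bool" where
  "existence L le \<kappa> M ind \<longleftrightarrow>
     (\<forall>a A B. le A B \<and> small_strong le \<kappa> M B \<and> set a \<subseteq> carrier M \<longrightarrow>
        (\<exists>q \<in> types_over L M B. tp_restrict L M q A = tp L M a A \<and> (\<exists>b \<in> q. ind b A B)))"

definition uniqueness :: "'f language \<Rightarrow>
    (('f, 'a) algebra \<Rightarrow> ('f, 'a) algebra \<Rightarrow> bool) \<Rightarrow>
    'a rel \<Rightarrow>
    ('f, 'a) algebra \<Rightarrow>
    ('a list \<Rightarrow> ('f, 'a) algebra \<Rightarrow> ('f, 'a) algebra \<Rightarrow> bool) \<Rightarrow> bool" where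
  "uniqueness L le \<kappa> M ind \<longleftrightarrow>
     (\<forall>a b A B. le A B \<and> small_strong le \<kappa> M B \<and> ind a A B \<and> ind b A B \<and>
        tp L M a A = tp L M b A \<longrightarrow> tp L M a B = tp L M b B)"

definition continuity :: "'f language \<Rightarrow>
    ('f, 'a) algebra set \<Rightarrow>
    (('f, 'a) algebra \<Rightarrow> ('f, 'a) algebra \<Rightarrow> bool) \<Rightarrow>
    'a rel \<Rightarrow>
    ('f, 'a) algebra \<Rightarrow>
    ('a list \<Rightarrow> ('f, 'a) algebra \<Rightarrow> ('f, 'a) algebra \<Rightarrow> bool) \<Rightarrow> bool" where
  "continuity L K le \<kappa> M ind \<longleftrightarrow>
     (\<forall>r A A\<^sub>\<delta> i\<^sub>0 a c. cont_chain L K le r A \<and> limit_seg r (Field r) \<and>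
        is_union L (Field r) A A\<^sub>\<delta> \<and> small_strong le \<kappa> M A\<^sub>\<delta> \<and>
        i\<^sub>0 \<in> Field r \<and> (\<forall>i \<in> Field r. (i\<^sub>0, i) \<in> r) \<and>
        set a \<subseteq> carrier M \<and> (\<forall>i \<in> Field r. set (c i) \<subseteq> carrier M) \<and>
        (\<forall>i \<in> Field r. ind (c i) (A i\<^sub>0) (A i) \<and> tp L M (c i) (A i) = tp L M a (A i)) \<longrightarrow>
        ind a (A i\<^sub>0) A\<^sub>\<delta>)"

definition weak_independence_calculus :: "'f language \<Rightarrow>
    ('f, 'a) algebra set \<Rightarrow>
    (('f, 'a) algebra \<Rightarrow> ('f, 'a) algebra \<Rightarrow> bool) \<Rightarrow>
    'a rel \<Rightarrow>
    ('f, 'a) algebra \<Rightarrow>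
    ('a list \<Rightarrow> ('f, 'a) algebra \<Rightarrow> ('f, 'a) algebra \<Rightarrow> bool) \<Rightarrow> bool" where
  "weak_independence_calculus L K le \<kappa> M ind \<longleftrightarrow>
     ind_typed le \<kappa> M ind \<and>
     invariance L M ind \<and>
     disjointness ind \<and>
     symmetry le \<kappa> M ind \<and>
     monotonicity le \<kappa> M ind \<and>
     existence L le \<kappa> M ind \<and>
     uniqueness L le \<kappa> M ind \<and>
     continuity L K le \<kappa> M ind"

definition superstable_local_character :: "'f language \<Rightarrow> ('f, 'a) algebra set \<Rightarrow>
    (('f, 'a) algebra \<Rightarrow> ('f, 'a) algebra \<Rightarrow> bool) \<Rightarrow> 'a rel \<Rightarrow> ('f, 'a) algebra \<Rightarrow>
    ('a list \<Rightarrow> ('f, 'a) algebra \<Rightarrow> ('f, 'a) algebra \<Rightarrow> bool) \<Rightarrow> bool" where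
  "superstable_local_character L K le \<kappa> M ind \<longleftrightarrow>
     (\<forall>r A A\<^sub>\<delta> a. cont_chain L K le r A \<and> limit_seg r (Field r) \<and>
        is_union L (Field r) A A\<^sub>\<delta> \<and> small_strong le \<kappa> M A\<^sub>\<delta> \<and> set a \<subseteq> carrier M \<longrightarrow>
        (\<exists>\<alpha> \<in> Field r. ind a (A \<alpha>) A\<^sub>\<delta>))"

definition superstable_independence_calculus :: "'f language \<Rightarrow> ('f, 'a) algebra set \<Rightarrow>
    (('f, 'a) algebra \<Rightarrow> ('f, 'a) algebra \<Rightarrow> bool) \<Rightarrow> 'a rel \<Rightarrow> ('f, 'a) algebra \<Rightarrow>
    ('a list \<Rightarrow> ('f, 'a) algebra \<Rightarrow> ('f, 'a) algebra \<Rightarrow> bool) \<Rightarrow> bool" where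
  "superstable_independence_calculus L K le \<kappa> M ind \<longleftrightarrow>
     weak_independence_calculus L K le \<kappa> M ind \<and> superstable_local_character L K le \<kappa> M ind"

definition set_ind :: "('a list \<Rightarrow> ('f, 'a) algebra \<Rightarrow> ('f, 'a) algebra \<Rightarrow> bool) \<Rightarrow>
    'a set \<Rightarrow> ('f, 'a) algebra \<Rightarrow> ('f, 'a) algebra \<Rightarrow> bool" where
  "set_ind ind B A C \<longleftrightarrow> (\<forall>b. set b \<subseteq> B \<longrightarrow> ind b A C)"

abbreviation join :: "'f language \<Rightarrow> ('f, 'a) algebra \<Rightarrow> ('f, 'a) algebra \<Rightarrow> ('f, 'a) algebra \<Rightarrow> ('f, 'a) algebra" where
  "join L M B C \<equiv> gen L M (carrier B \<union> carrier C)"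

definition free_ind :: "'f language \<Rightarrow> ('f, 'a) algebra set \<Rightarrow>
    (('f, 'a) algebra \<Rightarrow> ('f, 'a) algebra \<Rightarrow> bool) \<Rightarrow> ('f, 'a) algebra \<Rightarrow>
    ('f, 'a) algebra \<Rightarrow> ('f, 'a) algebra \<Rightarrow> ('f, 'a) algebra \<Rightarrow> bool" where
  "free_ind L V le M B A C \<longleftrightarrow>
     free_amalgam L V A B C (join L M B C) \<and> le (join L M B C) M"

text \<open>In the last clause the free amalgam of \<open>B\<close> and \<open>C\<close> over
  \<open>A\<close> is the internal one, that is, the subalgebra of \<open>D\<close> generated by
  \<open>B\<close> and \<open>C\<close>.\<close>

definition nice_wrt_free_factors :: "'f language \<Rightarrow> ('f, 'a) algebra set \<Rightarrow> ('f, 'a) algebra set \<Rightarrow>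
    (('f, 'a) algebra \<Rightarrow> ('f, 'a) algebra \<Rightarrow> bool) \<Rightarrow> 'a rel \<Rightarrow> ('f, 'a) algebra \<Rightarrow>
    ('a list \<Rightarrow> ('f, 'a) algebra \<Rightarrow> ('f, 'a) algebra \<Rightarrow> bool) \<Rightarrow> bool" where
  "nice_wrt_free_factors L V K le \<kappa> M ind \<longleftrightarrow>
     (\<exists>n. \<forall>m \<ge> n. free_of_rank L V m \<subseteq> K) \<and>
     (\<exists>m. \<forall>A \<in> free_algs L V. \<forall>B \<in> free_algs L V. \<forall>C \<in> free_algs L V.
        small_strong le \<kappa> M A \<and> small_strong le \<kappa> M B \<and> small_strong le \<kappa> M C \<and>
        ff L V A B \<and> ff L V A C \<and> rank_at_least L V m A \<longrightarrow>
        (set_ind ind (carrier B) A C \<longleftrightarrow> free_ind L V le M B A C)) \<and>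
     (\<forall>A \<in> free_fin L V \<inter> K. \<forall>B \<in> free_algs L V \<inter> K. \<forall>C \<in> free_algs L V \<inter> K.
        small_strong le \<kappa> M A \<and> small_strong le \<kappa> M B \<and> small_strong le \<kappa> M C \<and> ff L V A C \<longrightarrow>
        (\<forall>c \<in> carrier C. ind [c] A B \<longrightarrow>
           (\<exists>D \<in> free_fin L V. c \<in> carrier D \<and> ff L V A D \<and> ff L V D C \<and>
              set_ind ind (carrier D) A B))) \<and>
     (\<forall>A \<in> free_fin L V \<inter> K. \<forall>B \<in> free_fin L V \<inter> K. \<forall>C \<in> free_fin L V \<inter> K.
        \<forall>D \<in> free_algs L V \<inter> K.
        small_strong le \<kappa> M A \<and> small_strong le \<kappa> M B \<and> small_strong le \<kappa> M C \<and>
        small_strong le \<kappa> M D \<and>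
        ff L V A B \<and> ff L V B D \<and> ff L V A C \<and> ff L V C D \<and> set_ind ind (carrier B) A C \<longrightarrow>
        free_amalgam L V A B C (join L D B C) \<and> ff L V (join L D B C) D)"

end

theory Submission
  imports Defs "HOL-Library.Countable_Set_Type"
begin

text \<open>
  Let \<open>A \<le> B\<close> and \<open>a\<close> witness the Construction Principle and place
  \<open>B\<close> strongly in the monster model.  Call a finite \<open>Y \<subseteq> B\<close> good if
  \<open>Y \<union> {a\<^sub>0, \<dots>, a\<^sub>i}\<close> is part of a basis of \<open>B\<close> for every
  \<open>i\<close>; the empty set is good.  Given a good \<open>Y\<close> and \<open>b \<in> B\<close>, local
  character along the chain \<open>E\<^sub>i = \<langle>Y, a\<^sub>0, \<dots>, a\<^sub>i\<rangle>\<close> makes \<open>b\<close>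
  independent over some \<open>E\<^sub>k\<close> from the union of the chain.  Clause 3 of niceness puts
  \<open>b\<close> into a free factor \<open>D\<close> of \<open>B\<close> of finite rank that extends
  \<open>E\<^sub>k\<close> and is independent from the union, and by clause 4 a basis of \<open>D\<close>
  extending that of \<open>E\<^sub>k\<close> is again good.  Running through an enumeration of \<open>B\<close>
  yields a basis of \<open>B\<close> containing all \<open>a\<^sub>i\<close>, so \<open>A\<close> is a free factor of
  \<open>B\<close>.  This contradicts the Construction Principle for the free product of \<open>B\<close> with the
  free algebra of rank 0.
\<close>

section \<open>Subalgebras and homomorphisms\<close>

lemma args_mono: "args L S f xs \<Longrightarrow> S \<subseteq> T \<Longrightarrow> args L T f xs"
  by (auto simp: args_def)

lemma substrD:
  assumes "substr L A B"
  shows "alg L A" "alg L B" "carrier A \<subseteq> carrier B"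
    "args L (carrier A) f xs \<Longrightarrow> interp A f xs = interp B f xs"
  using assms by (auto simp: substr_def)

lemma alg_closed: "alg L A \<Longrightarrow> args L (carrier A) f xs \<Longrightarrow> interp A f xs \<in> carrier A"
  by (auto simp: alg_def)

lemma substr_refl: "alg L A \<Longrightarrow> substr L A A"
  by (auto simp: substr_def)

lemma substr_trans: "substr L A B \<Longrightarrow> substr L B C \<Longrightarrow> substr L A C"
  unfolding substr_def by (auto simp: args_mono)

text \<open>On arguments from the common carrier both inherit the operations of \<open>C\<close>;
  everywhere else both are \<open>undefined\<close>.\<close>

lemma substr_eqI:
  assumes "substr L A C" "substr L B C" "carrier A = carrier B"
  shows "A = B"
proof -
  have "interp A f xs = interp B f xs" for f xs
    using assms unfolding substr_def alg_def by (cases "args L (carrier A) f xs") auto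
  then show ?thesis using assms(3) by (intro algebra.equality) auto
qed

lemma substr_restrict:
  "substr L A C \<Longrightarrow> substr L B C \<Longrightarrow> carrier A \<subseteq> carrier B \<Longrightarrow> substr L A B"
  unfolding substr_def by (auto simp: args_mono)

section \<open>Generated subalgebras\<close>

lemma carrier_induced [simp]: "carrier (induced L B S) = S"
  by (simp add: induced_def)

lemma substr_induced:
  assumes "alg L B" "S \<subseteq> carrier B" "\<And>f xs. args L S f xs \<Longrightarrow> interp B f xs \<in> S"
  shows "substr L (induced L B S) B"
  using assms unfolding substr_def alg_def induced_def by auto

lemma induced_substr: "substr L A B \<Longrightarrow> induced L B (carrier A) = A"
proof (rule substr_eqI[of L _ B])
  assume s: "substr L A B"
  show "substr L (induced L B (carrier A)) B"
    using substrD[OF s] alg_closed[of L A] by (intro substr_induced) metis+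
qed auto

lemma gen_substr:
  assumes "alg L B" "X \<subseteq> carrier B"
  shows "substr L (gen L B X) B"
  unfolding gen_def
proof (rule substr_induced[OF assms(1)])
  let ?S = "\<Inter>{carrier A | A. substr L A B \<and> X \<subseteq> carrier A}"
  show "?S \<subseteq> carrier B" using assms substr_refl by blast
  fix f xs assume a: "args L ?S f xs"
  show "interp B f xs \<in> ?S"
  proof clarify
    fix A assume A: "substr L A B" "X \<subseteq> carrier A"
    then have "args L (carrier A) f xs" using a by (elim args_mono) blast
    then show "interp B f xs \<in> carrier A"
      using A substrD(1,4)[OF A(1)] alg_closed by metis
  qed
qed

lemma gen_subset: "X \<subseteq> carrier (gen L B X)"
  by (auto simp: gen_def)

lemma gen_least: "substr L A B \<Longrightarrow> X \<subseteq> carrier A \<Longrightarrow> carrier (gen L B X) \<subseteq> carrier A"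
  by (auto simp: gen_def)

lemma gen_mono:
  assumes "alg L B" "Y \<subseteq> carrier B" "X \<subseteq> Y"
  shows "substr L (gen L B X) (gen L B Y)"
proof -
  have "X \<subseteq> carrier (gen L B Y)" using gen_subset[of Y L B] assms by blast
  then show ?thesis
    using assms gen_substr[of L B X] gen_substr[of L B Y] gen_least[of L "gen L B Y" B X]
    by (meson order_trans substr_restrict)
qed

text \<open>Each side is a subalgebra of both \<open>A\<close> and \<open>B\<close> that contains
  \<open>X\<close>, so minimality gives both inclusions.\<close>

lemma gen_in_substr:
  assumes "substr L A B" "X \<subseteq> carrier A"
  shows "gen L A X = gen L B X"
proof -
  have X: "X \<subseteq> carrier B" using assms substrD(3) by blast
  have 1: "substr L (gen L A X) A" "substr L (gen L B X) B"
    using gen_substr[OF substrD(1)[OF assms(1)] assms(2)] gen_substr[OF substrD(2)[OF assms(1)] X] .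
  then have 2: "substr L (gen L A X) B" using substr_trans assms(1) by blast
  have 3: "substr L (gen L B X) A"
    using gen_least[OF assms] by (rule substr_restrict[OF 1(2) assms(1)])
  show ?thesis
    using gen_least[OF 2 gen_subset] gen_least[OF 3 gen_subset] by (intro substr_eqI[OF 2 1(2)]) auto
qed

lemma gen_least_eq:
  assumes "substr L A B" "gen L A X = A" "X \<subseteq> carrier A"
  shows "gen L B X = A"
  using gen_in_substr[OF assms(1,3)] assms(2) by simp

lemma gen_eq_whole:
  assumes "alg L B" "Y \<subseteq> carrier B" "gen L B X = B" "X \<subseteq> carrier (gen L B Y)"
  shows "gen L B Y = B"
proof -
  have s: "substr L (gen L B Y) B" using assms gen_substr by blast
  have "carrier B \<subseteq> carrier (gen L B Y)" using gen_least[OF s assms(4)] assms(3) by simp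
  then show ?thesis using s substrD(3)[OF s] by (intro substr_eqI[OF s substr_refl[OF assms(1)]]) auto
qed

section \<open>Homomorphisms and finite character of generation\<close>

lemma homD:
  assumes "hom L h A B"
  shows "alg L A" "alg L B" "x \<in> carrier A \<Longrightarrow> h x \<in> carrier B"
    "args L (carrier A) f xs \<Longrightarrow> h (interp A f xs) = interp B f (map h xs)"
  using assms by (auto simp: hom_def)

lemma hom_args: "hom L h A B \<Longrightarrow> args L (carrier A) f xs \<Longrightarrow> args L (carrier B) f (map h xs)"
  by (auto simp: args_def hom_def)

lemma hom_restrict:
  assumes "hom L h B D" "substr L A B"
  shows "hom L h A D"
  using substrD[OF assms(2)] homD[OF assms(1)] unfolding hom_def
  by (auto simp: args_mono)

lemma hom_comp: "hom L h A B \<Longrightarrow> hom L g B C \<Longrightarrow> hom L (g \<circ> h) A C"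
  using hom_args[of L h A B] unfolding hom_def by (auto simp: Pi_iff)

lemma hom_id_substr: "substr L A B \<Longrightarrow> hom L id A B"
  unfolding hom_def substr_def by auto

lemma hom_substr_codomain:
  assumes "hom L h A B" "substr L C B" "h ` carrier A \<subseteq> carrier C"
  shows "hom L h A C"
  unfolding hom_def
proof (intro conjI allI impI)
  show "alg L A" "alg L C" "h \<in> carrier A \<rightarrow> carrier C" using homD(1)[OF assms(1)] substrD[OF assms(2)] assms(3) by auto
  fix f xs assume a: "args L (carrier A) f xs"
  then have "args L (carrier C) f (map h xs)" using assms(3) by (auto simp: args_def)
  then show "h (interp A f xs) = interp C f (map h xs)"
    using homD(4)[OF assms(1) a] substrD(4)[OF assms(2)] by simp
qed

text \<open>The equaliser of two homomorphisms is a subalgebra, hence everything once it contains a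
  generating set.\<close>

lemma hom_eq_on_gen:
  assumes "hom L h A D" "hom L g A D" "gen L A X = A" "X \<subseteq> carrier A"
    "\<And>x. x \<in> X \<Longrightarrow> h x = g x" "x \<in> carrier A"
  shows "h x = g x"
proof -
  let ?S = "{x \<in> carrier A. h x = g x}"
  have "substr L (induced L A ?S) A"
  proof (rule substr_induced)
    show "alg L A" using homD(1)[OF assms(1)] .
    fix f xs assume a: "args L ?S f xs"
    then have b: "args L (carrier A) f xs" by (rule args_mono) auto
    have "map h xs = map g xs" using a by (auto simp: args_def)
    then show "interp A f xs \<in> ?S"
      using b homD(4)[OF assms(1) b] homD(4)[OF assms(2) b] alg_closed[OF homD(1)[OF assms(1)] b] by (simp del: map_eq_conv)
  qed auto
  from gen_least[OF this, of X] assms show ?thesis by auto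
qed

text \<open>Operations are finitary: finitely many arguments from subalgebras generated by finite
  subsets of \<open>W\<close> lie in a single such subalgebra, so the union of all of these is
  closed under the operations.\<close>

lemma gen_finite_char:
  assumes B: "alg L B" and W: "W \<subseteq> carrier B" and x: "x \<in> carrier (gen L B W)"
  shows "\<exists>F. finite F \<and> F \<subseteq> W \<and> x \<in> carrier (gen L B F)"
proof -
  let ?S = "\<Union>F \<in> {F. finite F \<and> F \<subseteq> W}. carrier (gen L B F)"
  have gm: "carrier (gen L B F) \<subseteq> carrier (gen L B G)" if "F \<subseteq> G" "G \<subseteq> W" for F G
    using substrD(3)[OF gen_mono[OF B, of G F]] that W by simp
  have gs: "substr L (gen L B F) B" if "F \<subseteq> W" for F
    using gen_substr[OF B] that W by blast
  have "substr L (induced L B ?S) B"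
  proof (rule substr_induced[OF B])
    show "?S \<subseteq> carrier B" using substrD(3)[OF gs] by blast
    fix f xs assume a: "args L ?S f xs"
    then have "\<forall>x \<in> set xs. \<exists>F. finite F \<and> F \<subseteq> W \<and> x \<in> carrier (gen L B F)"
      by (auto simp: args_def)
    then obtain \<F> where F: "\<And>x. x \<in> set xs \<Longrightarrow> finite (\<F> x) \<and> \<F> x \<subseteq> W \<and> x \<in> carrier (gen L B (\<F> x))"
      by metis
    let ?F = "\<Union>x \<in> set xs. \<F> x"
    have fF: "finite ?F" "?F \<subseteq> W" using F by auto
    have "x \<in> carrier (gen L B ?F)" if "x \<in> set xs" for x
      using F[OF that] gm[of "\<F> x" ?F] fF that by blast
    then have b: "args L (carrier (gen L B ?F)) f xs" using a by (auto simp: args_def)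
    then have "interp B f xs \<in> carrier (gen L B ?F)"
      using substrD(1,4)[OF gs[OF fF(2)]] alg_closed by metis
    then show "interp B f xs \<in> ?S" using fF by blast
  qed
  moreover have "W \<subseteq> ?S"
  proof
    fix w assume "w \<in> W"
    then show "w \<in> ?S" using gen_subset[of "{w}" L B] by (intro UN_I[of "{w}"]) auto
  qed
  ultimately show ?thesis using gen_least[of L "induced L B ?S" B W] x by auto
qed

lemma gen_finite_char_set:
  assumes B: "alg L B" and W: "W \<subseteq> carrier B" and X: "finite X" "X \<subseteq> carrier (gen L B W)"
  shows "\<exists>F. finite F \<and> F \<subseteq> W \<and> X \<subseteq> carrier (gen L B F)"
proof -
  obtain \<F> where F: "\<And>x. x \<in> X \<Longrightarrow> finite (\<F> x) \<and> \<F> x \<subseteq> W \<and> x \<in> carrier (gen L B (\<F> x))"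
    using gen_finite_char[OF B W] X(2) by (metis subsetD)
  let ?F = "\<Union>x \<in> X. \<F> x"
  have fF: "finite ?F" "?F \<subseteq> W" using F X(1) by auto
  have "x \<in> carrier (gen L B ?F)" if "x \<in> X" for x
    using F[OF that] substrD(3)[OF gen_mono[OF B, of ?F "\<F> x"]] fF that W by blast
  then show ?thesis using fF by blast
qed

section \<open>Isomorphisms and images of embeddings\<close>

lemma iso_inv:
  assumes "iso L h A B"
  shows "iso L (inv_into (carrier A) h) B A"
proof -
  let ?g = "inv_into (carrier A) h"
  have h: "hom L h A B" "bij_betw h (carrier A) (carrier B)" using assms by (auto simp: iso_def)
  have g: "bij_betw ?g (carrier B) (carrier A)" using h(2) by (rule bij_betw_inv_into)
  have "hom L ?g B A" unfolding hom_def
  proof (intro conjI allI impI)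
    show "alg L B" "alg L A" "?g \<in> carrier B \<rightarrow> carrier A"
      using homD[OF h(1)] g by (auto simp: bij_betw_def)
    fix f xs assume a: "args L (carrier B) f xs"
    then have b: "args L (carrier A) f (map ?g xs)" using g by (auto simp: args_def bij_betw_def)
    have "map h (map ?g xs) = xs"
      using a h(2) by (auto simp: args_def bij_betw_inv_into_right intro!: map_idI)
    then have "interp B f xs = h (interp A f (map ?g xs))" using homD(4)[OF h(1) b] by simp
    then show "?g (interp B f xs) = interp A f (map ?g xs)"
      using alg_closed[OF homD(1)[OF h(1)] b] h(2) by (simp add: bij_betw_inv_into_left)
  qed
  then show ?thesis using g by (simp add: iso_def)
qed

lemma emb_iso_image:
  assumes "emb L h A B"
  shows "iso L h A (img L B h A)" "substr L (img L B h A) B"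
proof -
  have h: "hom L h A B" "inj_on h (carrier A)" using assms by (auto simp: emb_def)
  show s: "substr L (img L B h A) B"
  proof (rule substr_induced)
    show "alg L B" "h ` carrier A \<subseteq> carrier B" using homD[OF h(1)] by auto
    fix f xs assume a: "args L (h ` carrier A) f xs"
    let ?ys = "map (inv_into (carrier A) h) xs"
    have "\<And>y. y \<in> set xs \<Longrightarrow> y \<in> h ` carrier A" using a by (auto simp: args_def)
    then have e: "map h ?ys = xs" by (auto simp: f_inv_into_f intro!: map_idI)
    have b: "args L (carrier A) f ?ys" using a inv_into_into[of _ h "carrier A"] by (fastforce simp: args_def)
    have "interp B f xs = h (interp A f ?ys)" using homD(4)[OF h(1) b] e by simp
    then show "interp B f xs \<in> h ` carrier A" using alg_closed[OF homD(1)[OF h(1)] b] by auto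
  qed
  show "iso L h A (img L B h A)"
    using hom_substr_codomain[OF h(1) s] h(2) by (simp add: iso_def bij_betw_def)
qed

section \<open>Varieties and bases\<close>

text \<open>Membership in the carrier is part of the induction, since a homomorphism respects
  operations only on arguments from the carrier.\<close>

lemma trm_val_hom:
  assumes h: "hom L h A B" and v: "range v \<subseteq> carrier A" and "wf_trm L t"
  shows "trm_val A v t \<in> carrier A \<and> trm_val B (h \<circ> v) t = h (trm_val A v t)"
  using assms(3)
proof (induction t)
  case (Var n)
  then show ?case using v by auto
next
  case (App f ts)
  have a: "args L (carrier A) f (map (trm_val A v) ts)" using App by (auto simp: args_def)
  have e: "map (trm_val B (h \<circ> v)) ts = map h (map (trm_val A v) ts)" using App by (auto simp: comp_def)
  show ?case
    using homD(4)[OF h a] alg_closed[OF homD(1)[OF h] a] e by (simp del: map_map map_eq_conv comp_apply)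
qed

lemma variety_alg: "variety L V \<Longrightarrow> A \<in> V \<Longrightarrow> alg L A"
  by (auto simp: variety_def)

text \<open>An identity that holds in \<open>B\<close> under \<open>h \<circ> v\<close> is pulled
  back to \<open>A\<close> under \<open>v\<close> by injectivity of \<open>h\<close>. Subalgebras
  and isomorphic copies are the two cases of interest.\<close>

lemma variety_emb:
  assumes "variety L V" "B \<in> V" "emb L h A B"
  shows "A \<in> V"
proof -
  obtain E where "\<forall>(s, t) \<in> E. wf_trm L s \<and> wf_trm L t" and
    V: "V = {A. alg L A \<and>
                  (\<forall>(s, t) \<in> E. \<forall>v. range v \<subseteq> carrier A \<longrightarrow> trm_val A v s = trm_val A v t)}"
    using assms(1) unfolding variety_def by (elim exE conjE) (rule that)
  then have wf: "\<And>s t. (s, t) \<in> E \<Longrightarrow> wf_trm L s \<and> wf_trm L t" by blast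
  have h: "hom L h A B" "inj_on h (carrier A)" using assms(3) by (auto simp: emb_def)
  have "trm_val A v s = trm_val A v t" if st: "(s, t) \<in> E" and v: "range v \<subseteq> carrier A" for s t v
  proof -
    have "range (h \<circ> v) \<subseteq> carrier B" using v homD(3)[OF h(1)] by auto
    moreover have "\<forall>(s, t) \<in> E. \<forall>v. range v \<subseteq> carrier B \<longrightarrow> trm_val B v s = trm_val B v t"
      using assms(2) unfolding V by simp
    ultimately have "trm_val B (h \<circ> v) s = trm_val B (h \<circ> v) t" using st by blast
    then show ?thesis
      using trm_val_hom[OF h(1) v] wf[OF st] h(2) by (metis inj_onD)
  qed
  then show ?thesis unfolding V using homD(1)[OF h(1)] by auto
qed

lemma variety_substr: "variety L V \<Longrightarrow> B \<in> V \<Longrightarrow> substr L A B \<Longrightarrow> A \<in> V"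
  by (rule variety_emb[where h = id]) (auto simp: emb_def hom_id_substr)

lemma variety_iso: "variety L V \<Longrightarrow> A \<in> V \<Longrightarrow> iso L h A B \<Longrightarrow> B \<in> V"
  using iso_inv[of L h A B] by (auto simp: iso_def emb_def bij_betw_def intro: variety_emb)

section \<open>Free bases and free factors\<close>

lemma free_onD:
  assumes "free_on L V A X"
  shows "A \<in> V" "X \<subseteq> carrier A" "gen L A X = A"
    "\<And>D \<phi>. D \<in> V \<Longrightarrow> \<phi> \<in> X \<rightarrow> carrier D \<Longrightarrow> \<exists>h. hom L h A D \<and> (\<forall>x \<in> X. h x = \<phi> x)"
  using assms by (auto simp: free_on_def)

lemma free_on_iso:
  assumes V: "variety L V" and i: "iso L h A B" and f: "free_on L V A X"
  shows "free_on L V B (h ` X)"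
proof -
  let ?g = "inv_into (carrier A) h"
  have h: "hom L h A B" "bij_betw h (carrier A) (carrier B)" using i by (auto simp: iso_def)
  have g: "hom L ?g B A" using iso_inv[OF i] by (auto simp: iso_def)
  have BV: "B \<in> V" using variety_iso V i free_onD(1)[OF f] by blast
  have X: "h ` X \<subseteq> carrier B" using free_onD(2)[OF f] homD(3)[OF h(1)] by blast
  have algs: "alg L A" "alg L B" using homD(1,2)[OF h(1)] .
  have s: "substr L (gen L B (h ` X)) B" using gen_substr[OF algs(2) X] .
  have gh: "?g (h x) = x" if "x \<in> carrier A" for x using h(2) that by (simp add: bij_betw_inv_into_left)
  have hg: "h (?g x) = x" if "x \<in> carrier B" for x using h(2) that by (simp add: bij_betw_inv_into_right)
  \<comment> \<open>That the image of \<open>X\<close> generates \<open>B\<close> is read off in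
    \<open>A\<close>: the inverse of \<open>h\<close> maps \<open>?G\<close> onto a subalgebra
    containing the basis \<open>X\<close>, hence onto all of \<open>A\<close>.\<close>
  let ?G = "gen L B (h ` X)"
  have gG: "emb L ?g ?G A"
    using hom_restrict[OF g s] iso_inv[OF i] substrD(3)[OF s]
    by (auto simp: emb_def iso_def bij_betw_def intro: inj_on_subset)
  have "X \<subseteq> ?g ` carrier ?G"
  proof
    fix x assume x: "x \<in> X"
    then have "h x \<in> carrier ?G" using gen_subset[of "h ` X" L B] by (meson imageI subsetD)
    moreover have "x = ?g (h x)" using gh[of x] x free_onD(2)[OF f] by (metis subsetD)
    ultimately show "x \<in> ?g ` carrier ?G" by (rule rev_image_eqI)
  qed
  then have AG: "carrier A \<subseteq> ?g ` carrier ?G"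
    using gen_least[OF emb_iso_image(2)[OF gG], of X] free_onD(3)[OF f] by simp
  have "carrier B \<subseteq> carrier ?G"
  proof
    fix x assume x: "x \<in> carrier B"
    then obtain y where y: "y \<in> carrier ?G" "?g x = ?g y" using AG homD(3)[OF g x] by blast
    then have "x = y" using hg[OF x] hg[of y] substrD(3)[OF s] by auto
    then show "x \<in> carrier ?G" using y(1) by simp
  qed
  then have "?G = B"
    using substrD(3)[OF s] by (intro substr_eqI[OF s substr_refl[OF algs(2)]]) auto
  moreover have "\<exists>k. hom L k B D \<and> (\<forall>x \<in> h ` X. k x = \<phi> x)"
    if D: "D \<in> V" "\<phi> \<in> h ` X \<rightarrow> carrier D" for D \<phi>
  proof -
    have "\<phi> \<circ> h \<in> X \<rightarrow> carrier D" using D by auto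
    then obtain k where k: "hom L k A D" "\<forall>x \<in> X. k x = (\<phi> \<circ> h) x"
      using free_onD(4)[OF f D(1)] by blast
    then have "hom L (k \<circ> ?g) B D" using hom_comp g by blast
    moreover have "\<forall>x \<in> h ` X. (k \<circ> ?g) x = \<phi> x" using k(2) gh free_onD(2)[OF f] by auto
    ultimately show ?thesis by blast
  qed
  ultimately show ?thesis unfolding free_on_def using BV X by blast
qed

text \<open>The set \<open>Y\<close> may overlap \<open>X\<close>, which reduces enlarging and
  shrinking \<open>X\<close> to set algebra. The overlap is removed only where \<open>B\<close> is
  split into two factors.\<close>

definition part_of_basis :: "'f language \<Rightarrow> ('f, 'a) algebra set \<Rightarrow> ('f, 'a) algebra \<Rightarrow> 'a set \<Rightarrow> bool" where
  "part_of_basis L V B X \<longleftrightarrow> (\<exists>Y. free_on L V B (X \<union> Y))"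

lemma part_of_basis_mono: "part_of_basis L V B Y \<Longrightarrow> X \<subseteq> Y \<Longrightarrow> part_of_basis L V B X"
  unfolding part_of_basis_def by (metis Un_absorb1 Un_assoc)

text \<open>Needed because a map from \<open>X\<close> to the empty algebra need not extend to a superset of
  \<open>X\<close>.\<close>

lemma hom_to_empty:
  assumes "alg L D" "carrier D = {}" "alg L B"
  shows "hom L h (gen L B {}) D"
proof -
  have "\<not> args L (carrier D) f xs" for f xs using alg_closed[OF assms(1)] assms(2) by blast
  \<comment> \<open>An empty algebra rules out constants, so it is a subalgebra of every
    algebra.\<close>
  then have "substr L D B" using assms by (auto simp: substr_def)
  then have "carrier (gen L B {}) = {}" using gen_least[of L D B "{}"] assms by auto
  moreover have "alg L (gen L B {})" using substrD(1)[OF gen_substr[OF assms(3)]] by simp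
  ultimately show ?thesis using assms by (auto simp: hom_def alg_def)
qed

text \<open>A map on \<open>X\<close> is extended to the whole basis by a constant default value,
  then to \<open>B\<close>, and the resulting homomorphism is restricted.\<close>

lemma part_of_basis_free:
  assumes V: "variety L V" and p: "part_of_basis L V B X"
  shows "free_on L V (gen L B X) X"
proof -
  obtain Y where f: "free_on L V B (X \<union> Y)" using p by (auto simp: part_of_basis_def)
  have B: "alg L B" using variety_alg[OF V free_onD(1)[OF f]] .
  have X: "X \<subseteq> carrier B" using free_onD(2)[OF f] by auto
  have s: "substr L (gen L B X) B" using gen_substr[OF B X] .
  have "\<exists>h. hom L h (gen L B X) D \<and> (\<forall>x \<in> X. h x = \<phi> x)"
    if D: "D \<in> V" "\<phi> \<in> X \<rightarrow> carrier D" for D \<phi>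
  proof (cases "carrier D = {}")
    \<comment> \<open>An empty target offers no default value, but it also forces \<open>X\<close>
      to be empty.\<close>
    case True
    then have "X = {}" using D by auto
    then show ?thesis using hom_to_empty[OF variety_alg[OF V D(1)] True B] by auto
  next
    case False
    then obtain d where "d \<in> carrier D" by auto
    then have "(\<lambda>x. if x \<in> X then \<phi> x else d) \<in> X \<union> Y \<rightarrow> carrier D" using D by auto
    then obtain h where "hom L h B D" "\<forall>x \<in> X \<union> Y. h x = (if x \<in> X then \<phi> x else d)"
      using free_onD(4)[OF f D(1)] by blast
    then show ?thesis using hom_restrict[of L h B D, OF _ s] by auto
  qed
  then show ?thesis unfolding free_on_def
    using variety_substr[OF V free_onD(1)[OF f] s] gen_subset[of X L B] gen_in_substr[OF s gen_subset]
    by auto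
qed

text \<open>A basis \<open>Y\<close> of a complementary factor completes \<open>X\<close>: maps
  extend over each factor separately, and the coproduct property glues the extensions.\<close>

lemma ff_imp_part_of_basis:
  assumes V: "variety L V" and ff: "ff L V A B" and f: "free_on L V A X"
  shows "part_of_basis L V B X"
proof -
  obtain C Y where C: "free_on L V C Y" and p: "substr L A B" "substr L C B" "coproduct L V A id C id B"
    using ff by (auto simp: ff_def free_algs_def free_product_def)
  have BV: "B \<in> V" using p(3) by (simp add: coproduct_def)
  have XY: "X \<union> Y \<subseteq> carrier B" using free_onD(2)[OF f] free_onD(2)[OF C] substrD(3)[OF p(1)] substrD(3)[OF p(2)] by auto
  have univ: "\<exists>h. hom L h B D \<and> (\<forall>x \<in> carrier A. h x = u x) \<and> (\<forall>x \<in> carrier C. h x = w x) \<and>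
      (\<forall>h'. hom L h' B D \<and> (\<forall>x \<in> carrier A. h' x = u x) \<and> (\<forall>x \<in> carrier C. h' x = w x)
              \<longrightarrow> (\<forall>x \<in> carrier B. h' x = h x))"
    if "D \<in> V" "hom L u A D" "hom L w C D" for D u w
    using p(3) that unfolding coproduct_def by simp
  let ?G = "gen L B (X \<union> Y)"
  have s: "substr L ?G B" using gen_substr[OF substrD(2)[OF p(1)] XY] .
  have AG: "carrier A \<subseteq> carrier ?G"
    using gen_least_eq[OF p(1) free_onD(3,2)[OF f]] gen_mono[OF substrD(2)[OF p(1)] XY, of X]
    by (auto dest: substrD(3))
  have CG: "carrier C \<subseteq> carrier ?G"
    using gen_least_eq[OF p(2) free_onD(3,2)[OF C]] gen_mono[OF substrD(2)[OF p(1)] XY, of Y]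
    by (auto dest: substrD(3))
  have idA: "hom L id A ?G" "hom L id A B" using substr_restrict[OF p(1) s AG] p(1) hom_id_substr by blast+
  have idC: "hom L id C ?G" "hom L id C B" using substr_restrict[OF p(2) s CG] p(2) hom_id_substr by blast+
  \<comment> \<open>The coproduct property maps \<open>B\<close> into \<open>?G\<close>, identically
    on both factors. Viewed as an endomorphism of \<open>B\<close> this map is the identity by
    uniqueness, so \<open>?G\<close> is all of \<open>B\<close>.\<close>
  obtain h where h: "hom L h B ?G" "\<forall>x \<in> carrier A. h x = id x" "\<forall>x \<in> carrier C. h x = id x"
    using univ[OF variety_substr[OF V BV s] idA(1) idC(1)] by blast
  have hB: "hom L h B B" using hom_comp[OF h(1) hom_id_substr[OF s]] by simp
  have "h x = x" if "x \<in> carrier B" for x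
    using univ[OF BV idA(2) idC(2)] hB h(2,3) hom_id_substr[OF substr_refl[OF substrD(2)[OF p(1)]]] that
    by (metis id_apply)
  then have "carrier B \<subseteq> carrier ?G" using homD(3)[OF h(1)] by fastforce
  then have G: "?G = B"
    using substrD(3)[OF s] by (intro substr_eqI[OF s substr_refl[OF substrD(2)[OF s]]]) auto
  have "\<exists>h. hom L h B D \<and> (\<forall>x \<in> X \<union> Y. h x = \<phi> x)"
    if D: "D \<in> V" "\<phi> \<in> X \<union> Y \<rightarrow> carrier D" for D \<phi>
  proof -
    obtain u where u: "hom L u A D" "\<forall>x \<in> X. u x = \<phi> x" using free_onD(4)[OF f D(1), of \<phi>] D(2) by blast
    obtain w where w: "hom L w C D" "\<forall>x \<in> Y. w x = \<phi> x" using free_onD(4)[OF C D(1), of \<phi>] D(2) by blast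
    obtain h where "hom L h B D" "\<forall>x \<in> carrier A. h x = u x" "\<forall>x \<in> carrier C. h x = w x"
      using univ[OF D(1) u(1) w(1)] by blast
    then show ?thesis using u(2) w(2) free_onD(2)[OF f] free_onD(2)[OF C] by (metis Un_iff subsetD)
  qed
  then show ?thesis unfolding part_of_basis_def free_on_def using BV XY G by blast
qed

text \<open>Splitting a basis into \<open>X\<close> and the rest splits \<open>B\<close> into the
  subalgebras that the two pieces generate.\<close>

lemma part_of_basis_imp_ff:
  assumes V: "variety L V" and p: "part_of_basis L V B X"
  shows "ff L V (gen L B X) B"
proof -
  obtain Y where "free_on L V B (X \<union> Y)" using p by (auto simp: part_of_basis_def)
  then have f: "free_on L V B (X \<union> (Y - X))" by simp
  let ?Y = "Y - X"
  have py: "part_of_basis L V B ?Y" unfolding part_of_basis_def using f by (metis Un_commute)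
  note fX = part_of_basis_free[OF V p] and fY = part_of_basis_free[OF V py]
  have B: "alg L B" using variety_alg[OF V free_onD(1)[OF f]] .
  have sX: "substr L (gen L B X) B" and sY: "substr L (gen L B ?Y) B"
    using gen_substr[OF B, of X] gen_substr[OF B, of ?Y] free_onD(2)[OF f] by blast+
  have "coproduct L V (gen L B X) id (gen L B ?Y) id B"
    unfolding coproduct_def
  proof (intro conjI ballI allI impI)
    show "gen L B X \<in> V" "gen L B ?Y \<in> V" "B \<in> V" using fX fY f free_onD by blast+
    show "hom L id (gen L B X) B" "hom L id (gen L B ?Y) B" using sX sY hom_id_substr by blast+
    fix D u w assume D: "D \<in> V" and uw: "hom L u (gen L B X) D \<and> hom L w (gen L B ?Y) D"
    \<comment> \<open>Since \<open>X\<close> was removed from \<open>Y\<close>, this map agrees with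
      \<open>u\<close> on one piece and with \<open>w\<close> on the other.\<close>
    have "(\<lambda>x. if x \<in> X then u x else w x) \<in> X \<union> ?Y \<rightarrow> carrier D"
      using uw gen_subset[of X L B] gen_subset[of ?Y L B] homD(3)[of L u "gen L B X" D]
        homD(3)[of L w "gen L B ?Y" D] by (auto simp: subset_iff)
    then obtain h where h: "hom L h B D" "\<forall>x \<in> X \<union> ?Y. h x = (if x \<in> X then u x else w x)"
      using free_onD(4)[OF f D] by blast
    have 1: "h x = u x" if "x \<in> carrier (gen L B X)" for x
      using h(2) by (intro hom_eq_on_gen[OF hom_restrict[OF h(1) sX] conjunct1[OF uw] free_onD(3,2)[OF fX] _ that]) auto
    have 2: "h x = w x" if "x \<in> carrier (gen L B ?Y)" for x
      using h(2) by (intro hom_eq_on_gen[OF hom_restrict[OF h(1) sY] conjunct2[OF uw] free_onD(3,2)[OF fY] _ that]) auto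
    have 3: "h' x = h x" if "hom L h' B D" "\<forall>x \<in> carrier (gen L B X). h' x = u x"
       "\<forall>x \<in> carrier (gen L B ?Y). h' x = w x" "x \<in> carrier B" for h' x
    proof (rule hom_eq_on_gen[OF that(1) h(1) free_onD(3,2)[OF f] _ that(4)])
      fix x assume "x \<in> X \<union> ?Y"
      then have "x \<in> carrier (gen L B X) \<or> x \<in> carrier (gen L B ?Y)"
        using gen_subset[of X L B] gen_subset[of ?Y L B] by blast
      then show "h' x = h x" using that(2,3) 1[of x] 2[of x] by auto
    qed
    show "\<exists>h. hom L h B D \<and> (\<forall>x \<in> carrier (gen L B X). h (id x) = u x) \<and>
        (\<forall>x \<in> carrier (gen L B ?Y). h (id x) = w x) \<and>
        (\<forall>h'. hom L h' B D \<and> (\<forall>x \<in> carrier (gen L B X). h' (id x) = u x) \<and>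
          (\<forall>x \<in> carrier (gen L B ?Y). h' (id x) = w x) \<longrightarrow> (\<forall>x \<in> carrier B. h' x = h x))"
      using 1 2 3 by (intro exI[of _ h] conjI h(1)) auto
  qed
  then show ?thesis unfolding ff_def free_product_def free_algs_def
    using fX fY f sX sY by blast
qed

text \<open>Finite bases of different sizes can coexist, but not a finite and an infinite one. A
  finite \<open>F \<subseteq> Y\<close> already generates the finite basis and so \<open>D\<close>;
  a further \<open>y \<in> Y\<close> could be moved freely while \<open>F\<close> stays fixed, which
  leaves only one element in \<open>D\<close>.\<close>

lemma finite_basis:
  assumes V: "variety L V" and X: "free_on L V D X" "finite X" and Y: "free_on L V D Y"
  shows "finite Y"
proof (rule ccontr)
  assume inf: "infinite Y"
  have D: "alg L D" using variety_alg[OF V free_onD(1)[OF X(1)]] .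
  obtain F where F: "finite F" "F \<subseteq> Y" "X \<subseteq> carrier (gen L D F)"
    using gen_finite_char_set[OF D free_onD(2)[OF Y] X(2)] free_onD(2)[OF X(1)] free_onD(3)[OF Y] by auto
  have FD: "F \<subseteq> carrier D" using F(2) free_onD(2)[OF Y] by blast
  have gF: "gen L D F = D" using gen_eq_whole[OF D FD free_onD(3)[OF X(1)] F(3)] .
  obtain y where y: "y \<in> Y - F" using inf F(1) by (metis Diff_eq_empty_iff ex_in_conv finite_subset)
  have "z = y" if z: "z \<in> carrier D" for z
  proof -
    \<comment> \<open>The endomorphism sending \<open>y\<close> to \<open>z\<close> and fixing the
      rest of \<open>Y\<close> is the identity on the generating set \<open>F\<close>, hence
      everywhere.\<close>
    have "id(y := z) \<in> Y \<rightarrow> carrier D" using z free_onD(2)[OF Y] by auto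
    then obtain h where h: "hom L h D D" "\<forall>x \<in> Y. h x = (id(y := z)) x"
      using free_onD(4)[OF Y free_onD(1)[OF Y]] by blast
    have "h y = id y"
    proof (rule hom_eq_on_gen[OF h(1) hom_id_substr[OF substr_refl[OF D]] gF FD])
      fix x assume x: "x \<in> F"
      then have "x \<in> Y" "x \<noteq> y" using F(2) y by auto
      then show "h x = id x" using h(2) by auto
    qed (use y free_onD(2)[OF Y] in auto)
    then show "z = y" using h(2) y by auto
  qed
  then have "Y \<subseteq> {y}" using free_onD(2)[OF Y] by blast
  then show False using inf finite_subset by blast
qed

text \<open>Extensions of one map to \<open>B\<close> and to \<open>C\<close> agree on
  \<open>X\<close>, hence on \<open>A\<close>, and the amalgam property glues them. Generation holds
  because \<open>P\<close> is the join of \<open>B\<close> and \<open>C\<close> inside the ambient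
  algebra \<open>N\<close>.\<close>

lemma free_amalgam_basis:
  assumes V: "variety L V" and am: "free_amalgam L V A B C P" and P: "P = gen L N (carrier B \<union> carrier C)"
    and N: "substr L B N" "substr L C N"
    and A: "free_on L V A X" and B: "free_on L V B (X \<union> Z)" and C: "free_on L V C (X \<union> W)"
  shows "free_on L V P (X \<union> Z \<union> W)"
proof -
  let ?Y = "X \<union> Z \<union> W"
  have s: "substr L A B" "substr L A C" "substr L B P" "substr L C P" and PV: "P \<in> V"
    using am by (auto simp: free_amalgam_def)
  have Y: "?Y \<subseteq> carrier P"
    using free_onD(2)[OF B] free_onD(2)[OF C] substrD(3)[OF s(3)] substrD(3)[OF s(4)] by auto
  have sN: "substr L P N" unfolding P using gen_substr substrD(2,3)[OF N(1)] substrD(3)[OF N(2)] by blast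
  have BP: "substr L B (gen L P ?Y)" "substr L C (gen L P ?Y)"
    using gen_least_eq[OF s(3) free_onD(3,2)[OF B]] gen_mono[OF substrD(2)[OF s(3)] Y, of "X \<union> Z"]
      gen_least_eq[OF s(4) free_onD(3,2)[OF C]] gen_mono[OF substrD(2)[OF s(3)] Y, of "X \<union> W"] by auto
  have sG: "substr L (gen L P ?Y) P" using gen_substr[OF substrD(2)[OF s(3)] Y] .
  have "carrier P \<subseteq> carrier (gen L P ?Y)"
    using gen_least[OF substr_trans[OF sG sN], of "carrier B \<union> carrier C"] substrD(3)[OF BP(1)]
      substrD(3)[OF BP(2)] P by auto
  then have g: "gen L P ?Y = P"
    using substrD(3)[OF sG] by (intro substr_eqI[OF sG substr_refl[OF substrD(2)[OF sG]]]) auto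
  have "\<exists>h. hom L h P D \<and> (\<forall>x \<in> ?Y. h x = \<phi> x)" if D: "D \<in> V" "\<phi> \<in> ?Y \<rightarrow> carrier D" for D \<phi>
  proof -
    obtain u where u: "hom L u B D" "\<forall>x \<in> X \<union> Z. u x = \<phi> x" using free_onD(4)[OF B D(1), of \<phi>] D(2) by blast
    obtain w where w: "hom L w C D" "\<forall>x \<in> X \<union> W. w x = \<phi> x" using free_onD(4)[OF C D(1), of \<phi>] D(2) by blast
    have "\<forall>x \<in> carrier A. u x = w x"
      using hom_eq_on_gen[OF hom_restrict[OF u(1) s(1)] hom_restrict[OF w(1) s(2)] free_onD(3,2)[OF A]] u(2) w(2)
      by simp
    then obtain h where "hom L h P D" "\<forall>x \<in> carrier B. h x = u x" "\<forall>x \<in> carrier C. h x = w x"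
      using am D(1) u(1) w(1) unfolding free_amalgam_def by blast
    then show ?thesis using u(2) w(2) free_onD(2)[OF B] free_onD(2)[OF C] by (metis Un_iff subsetD)
  qed
  then show ?thesis unfolding free_on_def using PV Y g by blast
qed

text \<open>Freeness is a local property: the homomorphisms extending a map on the finite subsets of
  \<open>W\<close> are compatible, and by finite character they glue. Nothing is assumed about
  extending \<open>W\<close> as a whole to a basis of \<open>B\<close>.\<close>

lemma free_on_gen_locally:
  assumes V: "variety L V" and BV: "B \<in> V" and W: "W \<subseteq> carrier B"
    and loc: "\<And>F. finite F \<Longrightarrow> F \<subseteq> W \<Longrightarrow> part_of_basis L V B F"
  shows "free_on L V (gen L B W) W"
proof -
  have B: "alg L B" using variety_alg[OF V BV] .
  have s: "substr L (gen L B W) B" using gen_substr[OF B W] .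
  have sF: "substr L (gen L B F) (gen L B G)" if "F \<subseteq> G" "G \<subseteq> W" for F G
    using gen_mono[OF B] that W by auto
  have "\<exists>h. hom L h (gen L B W) D \<and> (\<forall>x \<in> W. h x = \<phi> x)" if D: "D \<in> V" "\<phi> \<in> W \<rightarrow> carrier D" for D \<phi>
  proof -
    have "\<exists>g. hom L g (gen L B F) D \<and> (\<forall>x \<in> F. g x = \<phi> x)" if "finite F" "F \<subseteq> W" for F
      using free_onD(4)[OF part_of_basis_free[OF V loc[OF that]] D(1), of \<phi>] D(2) that by blast
    then obtain g where g: "\<And>F. finite F \<Longrightarrow> F \<subseteq> W \<Longrightarrow> hom L (g F) (gen L B F) D"
      "\<And>F x. finite F \<Longrightarrow> F \<subseteq> W \<Longrightarrow> x \<in> F \<Longrightarrow> g F x = \<phi> x" by metis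
    have mono: "g G x = g F x" if "F \<subseteq> G" "finite G" "G \<subseteq> W" "x \<in> carrier (gen L B F)" for F G x
    proof -
      have fF: "finite F" "F \<subseteq> W" using that finite_subset by auto
      show ?thesis
      proof (rule hom_eq_on_gen[OF hom_restrict[OF g(1) sF] g(1) _ _ _ that(4)])
        show "gen L (gen L B F) F = gen L B F" "F \<subseteq> carrier (gen L B F)"
          using free_onD(3,2)[OF part_of_basis_free[OF V loc[OF fF]]] .
        show "g G x = g F x" if "x \<in> F" for x using g(2) that \<open>F \<subseteq> G\<close> fF \<open>finite G\<close> \<open>G \<subseteq> W\<close> by (metis subsetD)
      qed (use that fF in auto)
    qed
    \<comment> \<open>The choice of \<open>F\<close> is immaterial: two candidates are compared
      through their union.\<close>
    define h where "h x = g (SOME F. finite F \<and> F \<subseteq> W \<and> x \<in> carrier (gen L B F)) x" for x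
    have hg: "h x = g F x" if F: "finite F" "F \<subseteq> W" "x \<in> carrier (gen L B F)" for F x
    proof -
      let ?G = "SOME F. finite F \<and> F \<subseteq> W \<and> x \<in> carrier (gen L B F)"
      have "\<exists>F. finite F \<and> F \<subseteq> W \<and> x \<in> carrier (gen L B F)" using F by blast
      then have G: "finite ?G \<and> ?G \<subseteq> W \<and> x \<in> carrier (gen L B ?G)" by (rule someI_ex)
      have "g (F \<union> ?G) x = g F x" using F G by (intro mono) auto
      moreover have "g (F \<union> ?G) x = g ?G x" using F G by (intro mono) auto
      ultimately show ?thesis by (simp add: h_def)
    qed
    have "hom L h (gen L B W) D" unfolding hom_def
    proof (intro conjI allI impI)
      show "alg L (gen L B W)" "alg L D" using substrD(1)[OF s] variety_alg[OF V D(1)] .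
      show "h \<in> carrier (gen L B W) \<rightarrow> carrier D"
      proof
        fix x assume "x \<in> carrier (gen L B W)"
        then obtain F where F: "finite F" "F \<subseteq> W" "x \<in> carrier (gen L B F)" using gen_finite_char[OF B W] by blast
        then show "h x \<in> carrier D" using hg[OF F] homD(3)[OF g(1)] by simp
      qed
      fix f xs assume a: "args L (carrier (gen L B W)) f xs"
      then obtain F where F: "finite F" "F \<subseteq> W" "set xs \<subseteq> carrier (gen L B F)"
        using gen_finite_char_set[OF B W, of "set xs"] by (auto simp: args_def)
      have b: "args L (carrier (gen L B F)) f xs" using a F by (auto simp: args_def)
      have e: "interp (gen L B W) f xs = interp (gen L B F) f xs"
        using substrD(4)[OF sF[OF F(2) subset_refl] b] by simp
      have "map h xs = map (g F) xs" using F hg by auto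
      then show "h (interp (gen L B W) f xs) = interp D f (map h xs)"
        using homD(4)[OF g(1)[OF F(1,2)] b] hg[OF F(1,2)] alg_closed[OF homD(1)[OF g(1)[OF F(1,2)]] b] e
        by (simp del: map_eq_conv)
    qed
    moreover have "h x = \<phi> x" if "x \<in> W" for x
      using hg[of "{x}" x] g(2)[of "{x}" x] gen_subset[of "{x}" L B] that by simp
    ultimately show ?thesis by blast
  qed
  then show ?thesis unfolding free_on_def
    using variety_substr[OF V BV s] gen_subset[of W L B] gen_in_substr[OF s gen_subset] by auto
qed

section \<open>Chains of type omega\<close>

text \<open>Chains are indexed by well-orders on \<open>'a\<close>, so the order of the natural
  numbers is copied along the injection \<open>c\<close>.\<close>

lemma omega_chain:
  fixes c :: "nat \<Rightarrow> 'a"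
  assumes c: "inj c" and K: "\<And>n. E n \<in> K" and le: "\<And>m n. m \<le> n \<Longrightarrow> le (E m) (E n)"
  shows "cont_chain L K le (dir_image natLeq c) (E \<circ> inv c)"
    "limit_seg (dir_image natLeq c) (Field (dir_image natLeq c))"
    "Field (dir_image natLeq c) = range c"
proof -
  let ?r = "dir_image natLeq c"
  have F: "Field ?r = range c" by (simp add: dir_image_Field Field_natLeq)
  have r: "(x, y) \<in> ?r \<longleftrightarrow> (\<exists>m n. x = c m \<and> y = c n \<and> m \<le> n)" for x y
    by (auto simp: dir_image_def natLeq_def)
  have rc: "(c m, c n) \<in> ?r \<longleftrightarrow> m \<le> n" for m n
    unfolding r using injD[OF c] by blast
  have "Well_order ?r"
    using c by (intro Well_order_dir_image natLeq_Well_order) (simp add: Field_natLeq)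
  \<comment> \<open>Continuity is vacuous: a proper initial segment is empty or has the last element
    \<open>c (n - 1)\<close>.\<close>
  moreover have "\<not> limit_seg ?r (underS ?r i)" if "i \<in> Field ?r" for i
  proof
    assume l: "limit_seg ?r (underS ?r i)"
    obtain n where i: "i = c n" using \<open>i \<in> Field ?r\<close> F by blast
    have u: "underS ?r i = c ` {..<n}"
    proof
      show "underS ?r i \<subseteq> c ` {..<n}"
      proof
        fix x assume "x \<in> underS ?r i"
        then have x: "x \<noteq> c n" "(x, c n) \<in> ?r" by (auto simp: underS_def i)
        then obtain m where m: "x = c m" using r by blast
        with x have "m \<le> n" "m \<noteq> n" using rc by auto
        then show "x \<in> c ` {..<n}" using m by auto
      qed
      show "c ` {..<n} \<subseteq> underS ?r i" using rc inj_eq[OF c] by (auto simp: underS_def i)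
    qed
    then have n: "n \<noteq> 0" using l by (auto simp: limit_seg_def)
    then have "c (n - 1) \<in> underS ?r i" unfolding u by simp
    then obtain k where "k \<in> underS ?r i" "c (n - 1) \<noteq> k" "(c (n - 1), k) \<in> ?r"
      using l unfolding limit_seg_def by blast
    then obtain m where "k = c m" "m < n" "m \<noteq> n - 1" "n - 1 \<le> m" using u rc by auto
    then show False by simp
  qed
  ultimately show "cont_chain L K le ?r (E \<circ> inv c)"
    unfolding cont_chain_def using K le F r c by (auto simp: inv_f_f)
  show "limit_seg ?r (Field ?r)"
    unfolding limit_seg_def F
  proof (intro conjI ballI)
    fix j assume "j \<in> range c"
    then obtain n where "j = c n" by blast
    then show "\<exists>k \<in> range c. j \<noteq> k \<and> (j, k) \<in> ?r"
      using rc inj_eq[OF c] by (intro bexI[of _ "c (Suc n)"]) auto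
  qed simp
  show "Field ?r = range c" by (rule F)
qed

lemma finite_subset_UN_chain:
  fixes X :: "nat \<Rightarrow> 'b set"
  assumes "finite F" "F \<subseteq> (\<Union>n. X n)" and mono: "\<And>m n. m \<le> n \<Longrightarrow> X m \<subseteq> X n"
  shows "\<exists>n. F \<subseteq> X n"
  using assms(1,2)
proof (induction F rule: finite_induct)
  case (insert x F)
  then obtain m n where "x \<in> X m" "F \<subseteq> X n" by auto
  moreover have "X m \<subseteq> X (max m n)" "X n \<subseteq> X (max m n)" by (auto intro!: mono)
  ultimately show ?case by blast
qed simp

text \<open>By finite character an element needs only finitely many generators, and these already
  lie in one \<open>X n\<close>.\<close>

lemma is_union_gen_chain:
  fixes X :: "nat \<Rightarrow> 'a set" and c :: "nat \<Rightarrow> 'a"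
  assumes B: "alg L B" and mono: "\<And>m n. m \<le> n \<Longrightarrow> X m \<subseteq> X n" and X: "\<And>n. X n \<subseteq> carrier B"
    and c: "inj c"
  shows "is_union L (range c) ((\<lambda>n. gen L B (X n)) \<circ> inv c) (gen L B (\<Union>n. X n))"
proof -
  have XB: "(\<Union>n. X n) \<subseteq> carrier B" using X by blast
  have s: "substr L (gen L B (X n)) (gen L B (\<Union>n. X n))" for n
    by (intro gen_mono[OF B XB]) blast
  have "carrier (gen L B (\<Union>n. X n)) \<subseteq> (\<Union>n. carrier (gen L B (X n)))"
  proof
    fix x assume "x \<in> carrier (gen L B (\<Union>n. X n))"
    then obtain F where F: "finite F" "F \<subseteq> (\<Union>n. X n)" "x \<in> carrier (gen L B F)"
      using gen_finite_char[OF B XB] by blast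
    then obtain n where n: "F \<subseteq> X n" using finite_subset_UN_chain[of F X] mono by blast
    show "x \<in> (\<Union>n. carrier (gen L B (X n)))"
      using F(3) substrD(3)[OF gen_mono[OF B X n]] by blast
  qed
  then show ?thesis unfolding is_union_def
    using s substrD(2)[OF s] substrD(3)[OF s] c by (auto simp: inv_f_f)
qed

section \<open>Extending part of a basis inside the monster model\<close>

lemma AEC_D:
  assumes "AEC L K le"
  shows "\<forall>A B. le A B \<longrightarrow> A \<in> K \<and> B \<in> K"
    "\<forall>A B. le A B \<longrightarrow> substr L A B"
    "\<forall>A \<in> K. le A A"
    "\<forall>A B C. le A B \<and> le B C \<longrightarrow> le A C"
    "\<forall>A B C. le A C \<and> le B C \<and> substr L A B \<longrightarrow> le A B"
    "\<forall>r A U. cont_chain L K le r A \<and> is_union L (Field r) A U \<longrightarrow>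
        U \<in> K \<and> (\<forall>j \<in> Field r. le (A j) U) \<and>
        (\<forall>B \<in> K. (\<forall>i \<in> Field r. le (A i) B) \<longrightarrow> le U B)"
  using assms unfolding AEC_def by - (elim conjE, assumption)+

lemma AEC_mem:
  assumes "AEC L K le" "le A B"
  shows "A \<in> K" "B \<in> K"
  using AEC_D(1)[OF assms(1)] assms(2) by blast+

lemma AEC_substr: "AEC L K le \<Longrightarrow> le A B \<Longrightarrow> substr L A B"
  using AEC_D(2) by blast

lemma AEC_refl: "AEC L K le \<Longrightarrow> A \<in> K \<Longrightarrow> le A A"
  using AEC_D(3) by blast

lemma AEC_trans: "AEC L K le \<Longrightarrow> le A B \<Longrightarrow> le B C \<Longrightarrow> le A C"
  using AEC_D(4)[of L K le] by blast

lemma AEC_coherence: "AEC L K le \<Longrightarrow> le A C \<Longrightarrow> le B C \<Longrightarrow> substr L A B \<Longrightarrow> le A B"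
  using AEC_D(5)[of L K le] by blast

lemma AEC_union:
  assumes "AEC L K le" "cont_chain L K le r A" "is_union L (Field r) A U"
  shows "U \<in> K" "j \<in> Field r \<Longrightarrow> le (A j) U"
    "B \<in> K \<Longrightarrow> (\<And>i. i \<in> Field r \<Longrightarrow> le (A i) B) \<Longrightarrow> le U B"
  using AEC_D(6)[OF assms(1)] assms(2,3) by blast+

text \<open>A Loewenheim-Skolem number is infinite by definition, and \<open>\<kappa>\<close>
  exceeds one.\<close>

lemma countable_ordLess_monster:
  assumes "monster L K le \<kappa> M" "countable S"
  shows "|S| <o \<kappa>"
proof -
  obtain \<mu> where \<mu>: "LS_cardinal L K le \<mu>" "\<mu> <o \<kappa>" using assms(1) by (auto simp: monster_def)
  have "|S| \<le>o natLeq" using assms(2) by (simp add: countable_card_le_natLeq)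
  also have "natLeq \<le>o |dom L| +c natLeq" using natLeq_Card_order by (rule ordLeq_csum2)
  also have "|dom L| +c natLeq \<le>o \<mu>" using \<mu>(1) by (simp add: LS_cardinal_def)
  finally show ?thesis using \<mu>(2) ordLeq_ordLess_trans by blast
qed

section \<open>The construction of a basis under superstability\<close>

locale nice_superstable =
  fixes L :: "'f language" and V K :: "('f, 'a) algebra set"
    and le :: "('f, 'a) algebra \<Rightarrow> ('f, 'a) algebra \<Rightarrow> bool"
    and \<kappa> :: "'a rel" and M :: "('f, 'a) algebra"
    and ind :: "'a list \<Rightarrow> ('f, 'a) algebra \<Rightarrow> ('f, 'a) algebra \<Rightarrow> bool"
  assumes V: "variety L V"
    and cov: "AEC_covering L V K le"
    and mon: "monster L K le \<kappa> M"
    and monotone: "monotonicity le \<kappa> M ind"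
    and loc: "superstable_local_character L K le \<kappa> M ind"
    and nice: "nice_wrt_free_factors L V K le \<kappa> M ind"
begin

lemma aec: "AEC L K le"
  using cov by (simp add: AEC_covering_def)

lemma ff_imp_le: "A \<in> K \<Longrightarrow> B \<in> K \<Longrightarrow> ff L V A B \<Longrightarrow> le A B"
  using cov unfolding AEC_covering_def ff_def by blast

lemma star1: "\<exists>n. \<forall>m \<ge> n. free_of_rank L V m \<subseteq> K"
  using nice unfolding nice_wrt_free_factors_def by blast

lemma star3:
  assumes "A \<in> free_fin L V \<inter> K" "B \<in> free_algs L V \<inter> K" "C \<in> free_algs L V \<inter> K"
    "small_strong le \<kappa> M A" "small_strong le \<kappa> M B" "small_strong le \<kappa> M C" "ff L V A C"
    "c \<in> carrier C" "ind [c] A B"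
  shows "\<exists>D \<in> free_fin L V. c \<in> carrier D \<and> ff L V A D \<and> ff L V D C \<and> set_ind ind (carrier D) A B"
  using nice assms unfolding nice_wrt_free_factors_def by simp

lemma star4:
  assumes "A \<in> free_fin L V \<inter> K" "B \<in> free_fin L V \<inter> K" "C \<in> free_fin L V \<inter> K"
    "D \<in> free_algs L V \<inter> K"
    "small_strong le \<kappa> M A" "small_strong le \<kappa> M B" "small_strong le \<kappa> M C"
    "small_strong le \<kappa> M D"
    "ff L V A B" "ff L V B D" "ff L V A C" "ff L V C D" "set_ind ind (carrier B) A C"
  shows "free_amalgam L V A B C (join L D B C)" "ff L V (join L D B C) D"
  using nice assms unfolding nice_wrt_free_factors_def by simp_all

text \<open>One round of the enumeration. Goodness concerns all initial segments of \<open>a\<close>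
  because the stage \<open>k\<close> given by local character is not known in advance.\<close>

lemma extend_step:
  fixes a :: "nat \<Rightarrow> 'a"
  assumes BK: "B \<in> K" and BM: "le B M" and cB: "countable (carrier B)" and a: "inj a"
    and Y: "finite Y" "\<And>i. part_of_basis L V B (Y \<union> a ` {..i})" and b: "b \<in> carrier B"
  shows "\<exists>Z. finite Z \<and> Y \<subseteq> Z \<and> (\<forall>i. part_of_basis L V B (Z \<union> a ` {..i})) \<and>
    b \<in> carrier (gen L B (Z \<union> range a))"
proof -
  obtain n where n: "\<And>m. n \<le> m \<Longrightarrow> free_of_rank L V m \<subseteq> K" using star1 by blast
  have Bfree: "B \<in> free_algs L V" using Y(2)[of 0] by (auto simp: part_of_basis_def free_algs_def)
  have BV: "B \<in> V" using Bfree free_onD(1) by (auto simp: free_algs_def)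
  have algB: "alg L B" using variety_alg[OF V BV] .
  \<comment> \<open>The offset \<open>n\<close> makes every \<open>X i\<close> have more than
    \<open>n\<close> elements, so that clause 1 of niceness puts \<open>E i\<close> into
    \<open>K\<close>.\<close>
  define X where "X i = Y \<union> a ` {..n + i}" for i
  define E where "E i = gen L B (X i)" for i
  have finX: "finite (X i)" for i using Y(1) by (simp add: X_def)
  have monoX: "X i \<subseteq> X j" if "i \<le> j" for i j using that by (auto simp: X_def)
  have pX: "part_of_basis L V B (X i)" for i using Y(2) by (simp add: X_def)
  have XB: "X i \<subseteq> carrier B" for i using pX free_onD(2) by (fastforce simp: part_of_basis_def)
  have fE: "free_on L V (E i) (X i)" for i unfolding E_def using part_of_basis_free[OF V pX] .
  \<comment> \<open>Stated for arbitrary finite bases above some \<open>X i\<close>, since it is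
    also needed for \<open>D\<close>, of which clause 3 gives only finite rank.\<close>
  have big: "D \<in> free_fin L V \<inter> K" if "free_on L V D S" "finite S" "X i \<subseteq> S" for D S i
  proof -
    have "n \<le> card (a ` {..n + i})" using a by (simp add: card_image inj_on_subset)
    also have "\<dots> \<le> card S" using that by (intro card_mono) (auto simp: X_def)
    finally have "D \<in> K" using n[of "card S"] that by (auto simp: free_of_rank_def)
    then show ?thesis using that by (auto simp: free_fin_def)
  qed
  have EK: "E i \<in> free_fin L V \<inter> K" for i using big[OF fE finX subset_refl] .
  have ffE: "ff L V (E i) B" for i unfolding E_def by (rule part_of_basis_imp_ff[OF V pX])
  have leE: "le (E i) B" for i using ff_imp_le EK BK ffE by blast
  have leEE: "le (E i) (E j)" if "i \<le> j" for i j
    using AEC_coherence[OF aec leE leE] gen_mono[OF algB XB monoX[OF that]] by (simp add: E_def)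
  have small: "small_strong le \<kappa> M C" if "le C B" for C
    using AEC_trans[OF aec that BM] substrD(3)[OF AEC_substr[OF aec that]] cB
      countable_ordLess_monster[OF mon] countable_subset by (auto simp: small_strong_def)
  define U where "U = gen L B (\<Union>i. X i)"
  let ?r = "dir_image natLeq a"
  have ch: "cont_chain L K le ?r (E \<circ> inv a)" "limit_seg ?r (Field ?r)" "Field ?r = range a"
    using omega_chain[OF a, of E K le] EK leEE by blast+
  have un: "is_union L (Field ?r) (E \<circ> inv a) U"
    using is_union_gen_chain[OF algB monoX XB a] unfolding ch(3) U_def E_def[abs_def] by simp
  have UK: "U \<in> K" using AEC_union(1)[OF aec ch(1) un] .
  have leEU: "le (E i) U" for i
    using AEC_union(2)[OF aec ch(1) un, of "a i"] a by (simp add: ch(3) inv_f_f)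
  have leUB: "le U B" using AEC_union(3)[OF aec ch(1) un BK] leE by simp
  \<comment> \<open>Clause 3 needs \<open>U\<close> to be free. Local freeness gives this whether or
    not \<open>U\<close> is a free factor of \<open>B\<close>.\<close>
  have "part_of_basis L V B F" if "finite F" "F \<subseteq> (\<Union>i. X i)" for F
    using finite_subset_UN_chain[OF that monoX] part_of_basis_mono[OF pX] by blast
  then have "free_on L V U (\<Union>i. X i)"
    unfolding U_def using XB by (intro free_on_gen_locally[OF V BV]) auto
  then have Ufree: "U \<in> free_algs L V \<inter> K" using UK by (auto simp: free_algs_def)
  have bM: "set [b] \<subseteq> carrier M" using b substrD(3)[OF AEC_substr[OF aec BM]] by auto
  \<comment> \<open>Superstability enters here.\<close>
  obtain \<alpha> where "\<alpha> \<in> Field ?r" "ind [b] ((E \<circ> inv a) \<alpha>) U"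
    using loc ch un small[OF leUB] bM unfolding superstable_local_character_def by blast
  then obtain k where k: "ind [b] (E k) U" using ch(3) a by (auto simp: inv_f_f)
  have Bs: "small_strong le \<kappa> M B" using small AEC_refl[OF aec BK] by blast
  obtain D where D: "D \<in> free_fin L V" "b \<in> carrier D" "ff L V (E k) D" "ff L V D B"
    "set_ind ind (carrier D) (E k) U"
    using star3[OF EK Ufree _ small[OF leE] small[OF leUB] Bs ffE b k] Bfree BK by blast
  obtain Z where Z: "free_on L V D (X k \<union> Z)"
    using ff_imp_part_of_basis[OF V D(3) fE] by (auto simp: part_of_basis_def)
  obtain S where "free_on L V D S" "finite S" using D(1) by (auto simp: free_fin_def)
  \<comment> \<open>Some basis of \<open>D\<close> is finite, hence so is the one that extends
    \<open>X k\<close>.\<close>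
  then have finZ: "finite (X k \<union> Z)" using finite_basis[OF V _ _ Z] by blast
  have DK: "D \<in> free_fin L V \<inter> K" using big[OF Z finZ] by blast
  have leDB: "le D B" using ff_imp_le D(4) DK BK by blast
  have pD: "part_of_basis L V B (X k \<union> Z)" using ff_imp_part_of_basis[OF V D(4) Z] .
  \<comment> \<open>Independence of \<open>D\<close> from \<open>U\<close> passes down to
    \<open>E j\<close>, so by clause 4 the join of \<open>D\<close> and \<open>E j\<close> is a free
    factor of \<open>B\<close>. As a free amalgam over \<open>E k\<close> it has the expected
    basis.\<close>
  have main: "part_of_basis L V B (X k \<union> Z \<union> X j)" if "k \<le> j" for j
  proof -
    have indj: "set_ind ind (carrier D) (E k) (E j)"
      unfolding set_ind_def
    proof (intro allI impI)
      fix d assume "set d \<subseteq> carrier D"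
      then have "ind d (E k) U" using D(5) by (simp add: set_ind_def)
      then show "ind d (E k) (E j)"
        using monotone leEE[OF order_refl] leEE[OF that] leEU small[OF leUB]
        unfolding monotonicity_def by blast
    qed
    have ffk: "ff L V (E k) (E j)"
    proof -
      have s: "substr L (E j) B" using AEC_substr[OF aec leE] .
      have "part_of_basis L V (E j) (X k)"
        using fE[of j] monoX[OF that] unfolding part_of_basis_def by (metis Un_absorb1)
      then have "ff L V (gen L (E j) (X k)) (E j)" by (rule part_of_basis_imp_ff[OF V])
      moreover have "gen L (E j) (X k) = E k"
        using gen_in_substr[OF s, of "X k"] monoX[OF that] free_onD(2)[OF fE, of j] by (auto simp: E_def)
      ultimately show ?thesis by simp
    qed
    have am: "free_amalgam L V (E k) D (E j) (join L B D (E j))" "ff L V (join L B D (E j)) B"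
      using star4[OF EK DK EK _ small[OF leE] small[OF leDB] small[OF leE] Bs D(3,4) ffk ffE indj]
        Bfree BK by auto
    \<comment> \<open>The basis of \<open>E j\<close> is put in the form required for the amalgam,
      with \<open>X j\<close> itself as the part added to \<open>X k\<close>.\<close>
    have "free_on L V (E j) (X k \<union> X j)" using fE[of j] monoX[OF that] by (simp add: Un_absorb1)
    then have "free_on L V (join L B D (E j)) (X k \<union> Z \<union> X j)"
      using free_amalgam_basis[OF V am(1) refl AEC_substr[OF aec leDB] AEC_substr[OF aec leE] fE Z] by blast
    then show ?thesis using ff_imp_part_of_basis[OF V am(2)] by blast
  qed
  \<comment> \<open>The index must reach \<open>k\<close> for \<open>main\<close> and
    \<open>i\<close> to cover the initial segment of \<open>a\<close>.\<close>
  have "part_of_basis L V B ((X k \<union> Z) \<union> a ` {..i})" for i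
    using main[of "max k i"] by (rule part_of_basis_mono) (auto simp: X_def)
  moreover have "b \<in> carrier (gen L B ((X k \<union> Z) \<union> range a))"
  proof -
    have "D = gen L B (X k \<union> Z)"
      using gen_least_eq[OF AEC_substr[OF aec leDB] free_onD(3,2)[OF Z]] by simp
    moreover have "X k \<union> Z \<union> range a \<subseteq> carrier B"
    proof -
      have "a i \<in> carrier B" for i using XB[of i] by (auto simp: X_def)
      then show ?thesis using XB[of k] free_onD(2)[OF Z] substrD(3)[OF AEC_substr[OF aec leDB]] by blast
    qed
    ultimately show ?thesis
      using D(2) substrD(3)[OF gen_mono[OF algB, of "X k \<union> Z \<union> range a" "X k \<union> Z"]] by blast
  qed
  ultimately show ?thesis using finZ by (intro exI[of _ "X k \<union> Z"]) (auto simp: X_def)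
qed

text \<open>Iterating \<open>extend_step\<close> along an enumeration of \<open>B\<close> gives a
  basis in the limit: finite subsets of the limit lie in one stage, which gives freeness, and every
  element of \<open>B\<close> is captured at its turn.\<close>

lemma range_part_of_basis:
  fixes a :: "nat \<Rightarrow> 'a"
  assumes BK: "B \<in> K" and BM: "le B M" and cB: "countable (carrier B)" and a: "inj a"
    and p: "\<And>i. part_of_basis L V B (a ` {..i})"
  shows "part_of_basis L V B (range a)"
proof -
  have BV: "B \<in> V" using p[of 0] free_onD(1) by (auto simp: part_of_basis_def)
  have algB: "alg L B" using variety_alg[OF V BV] .
  let ?P = "\<lambda>Y. finite Y \<and> (\<forall>i. part_of_basis L V B (Y \<union> a ` {..i}))"
  have PB: "Y \<union> range a \<subseteq> carrier B" if "?P Y" for Y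
  proof -
    have "Y \<union> a ` {..i} \<subseteq> carrier B" for i
      using that free_onD(2)[of L V B] unfolding part_of_basis_def by blast
    then show ?thesis by blast
  qed
  define e where "e = from_nat_into (carrier B)"
  have ne: "carrier B \<noteq> {}" using PB[of "{}"] p by auto
  have "\<exists>Y. \<forall>m. ?P (Y m) \<and> (Y m \<subseteq> Y (Suc m) \<and> e m \<in> carrier (gen L B (Y (Suc m) \<union> range a)))"
  proof (rule dependent_nat_choice)
    show "\<exists>Y. ?P Y" using p by (intro exI[of _ "{}"]) simp
    fix Y m assume "?P Y"
    then show "\<exists>Z. ?P Z \<and> (Y \<subseteq> Z \<and> e m \<in> carrier (gen L B (Z \<union> range a)))"
      using extend_step[OF BK BM cB a, of Y "e m"] from_nat_into[OF ne, of m] by (auto simp: e_def)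
  qed
  then obtain Y where Y: "\<And>m. ?P (Y m)" "\<And>m. Y m \<subseteq> Y (Suc m)"
    "\<And>m. e m \<in> carrier (gen L B (Y (Suc m) \<union> range a))" by blast
  \<comment> \<open>Adding only \<open>a 0\<close> to \<open>a m\<close> at stage \<open>m\<close>
    keeps each \<open>X m\<close> part of a basis by goodness, while the union still contains
    \<open>range a\<close>.\<close>
  define X where "X m = Y m \<union> a ` {..m}" for m
  define W where "W = (\<Union>m. X m)"
  have "Y m \<subseteq> Y n" if "m \<le> n" for m n using lift_Suc_mono_le[of Y, OF Y(2) that] .
  then have monoX: "X m \<subseteq> X n" if "m \<le> n" for m n using that by (fastforce simp: X_def)
  have WB: "W \<subseteq> carrier B" using PB[OF Y(1)] unfolding W_def X_def by blast
  have YW: "Y m \<union> range a \<subseteq> W" for m by (auto simp: W_def X_def)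
  have "part_of_basis L V B F" if "finite F" "F \<subseteq> W" for F
    using finite_subset_UN_chain[OF that[unfolded W_def] monoX] part_of_basis_mono Y(1)
    unfolding X_def by blast
  then have f: "free_on L V (gen L B W) W" by (rule free_on_gen_locally[OF V BV WB])
  have s: "substr L (gen L B W) B" using gen_substr[OF algB WB] .
  have "carrier B \<subseteq> carrier (gen L B W)"
  proof
    fix x assume "x \<in> carrier B"
    then obtain m where "x = e m" using cB by (metis e_def from_nat_into_surj)
    then show "x \<in> carrier (gen L B W)"
      using Y(3)[of m] substrD(3)[OF gen_mono[OF algB WB YW[of "Suc m"]]] by blast
  qed
  then have "gen L B W = B"
    using substrD(3)[OF s] by (intro substr_eqI[OF s substr_refl[OF algB]]) auto
  then show ?thesis using f YW[of 0] unfolding part_of_basis_def by (metis Un_absorb1 le_sup_iff)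
qed

end

section \<open>Transfer to the monster model and contradiction\<close>

lemma part_of_basis_iso:
  assumes "variety L V" "iso L h A B" "part_of_basis L V A X"
  shows "part_of_basis L V B (h ` X)"
  using assms free_on_iso[OF assms(1,2)] unfolding part_of_basis_def by (metis image_Un)

text \<open>Homomorphisms agree on what the empty set generates, so this factor adds no data to a
  homomorphism from \<open>B\<close>. It provides the coproduct that refutes the Construction
  Principle.\<close>

lemma coproduct_gen_empty:
  assumes V: "variety L V" and B: "B \<in> V"
  shows "coproduct L V B id (gen L B {}) id B"
proof -
  have algB: "alg L B" using variety_alg[OF V B] .
  have s: "substr L (gen L B {}) B" using gen_substr[OF algB] by simp
  have "f x = g x" if "hom L f B D" "hom L g (gen L B {}) D" "x \<in> carrier (gen L B {})" for f g D x
  proof (rule hom_eq_on_gen[OF hom_restrict[OF that(1) s] that(2) _ _ _ that(3)])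
    show "gen L (gen L B {}) {} = gen L B {}" using gen_in_substr[OF s, of "{}"] by simp
  qed auto
  then show ?thesis
    unfolding coproduct_def
    using B variety_substr[OF V B s] hom_id_substr[OF s] hom_id_substr[OF substr_refl[OF algB]]
    by fastforce
qed

theorem theorem1p12:
  fixes L :: "'f language"
    and V K :: "('f, 'a) algebra set"
    and le :: "('f, 'a) algebra \<Rightarrow> ('f, 'a) algebra \<Rightarrow> bool"
    and \<kappa> :: "'a rel"
    and M :: "('f, 'a) algebra"
    and ind :: "'a list \<Rightarrow> ('f, 'a) algebra \<Rightarrow> ('f, 'a) algebra \<Rightarrow> bool"
  assumes "countable (dom L)"
    and "variety L V"
    and "construction_principle L V"
    and "AEC_covering L V K le"
    and "monster L K le \<kappa> M"
    and "weak_independence_calculus L K le \<kappa> M ind"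
    and "nice_wrt_free_factors L V K le \<kappa> M ind"
  shows "\<not> superstable_independence_calculus L K le \<kappa> M ind"
proof
  assume "superstable_independence_calculus L K le \<kappa> M ind"
  then interpret nice_superstable L V K le \<kappa> M ind
    using assms unfolding nice_superstable_def superstable_independence_calculus_def
      weak_independence_calculus_def by blast
  obtain A B and a :: "nat \<Rightarrow> 'a" where B: "B \<in> free_inf L V" "countable (carrier B)"
    and AB: "substr L A B" and a: "inj a" "free_on L V A (range a)"
    and init: "\<And>i. ff L V (gen L B (a ` {..i})) B"
    and noff: "\<And>C P i j. C \<in> free_algs L V \<Longrightarrow> coproduct L V B i C j P \<Longrightarrow> \<not> ff L V (img L P i A) P"
    using assms(3) unfolding construction_principle_def by blast
  have BK: "B \<in> K" using B(1) assms(4) by (auto simp: AEC_covering_def)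
  have BV: "B \<in> V" using B(1) free_onD(1) by (auto simp: free_inf_def)
  \<comment> \<open>Independence lives inside \<open>M\<close>, so the argument is run in a strong
    copy \<open>?N\<close> of \<open>B\<close>.\<close>
  have "|carrier B| \<le>o \<kappa>"
    using countable_ordLess_monster[OF mon B(2)] ordLess_imp_ordLeq by blast
  then obtain h where h: "emb L h B M" "le (img L M h B) M"
    using mon BK unfolding monster_def strong_emb_def by blast
  let ?N = "img L M h B"
  have i: "iso L h B ?N" using emb_iso_image(1)[OF h(1)] .
  have aB: "range a \<subseteq> carrier B" using free_onD(2)[OF a(2)] substrD(3)[OF AB] by blast
  \<comment> \<open>A free factor yields part of a basis through a basis of the factor. The initial
    segment is one, being part of the basis \<open>range a\<close> of \<open>A\<close> and
    generating the same algebra in \<open>A\<close> as in \<open>B\<close>.\<close>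
  have "part_of_basis L V B (a ` {..i})" for i
  proof -
    have "a ` {..i} \<union> range a = range a" by auto
    then have "part_of_basis L V A (a ` {..i})"
      using a(2) unfolding part_of_basis_def by (intro exI[of _ "range a"]) simp
    moreover have "gen L A (a ` {..i}) = gen L B (a ` {..i})"
      using free_onD(2)[OF a(2)] by (intro gen_in_substr[OF AB]) blast
    ultimately have "free_on L V (gen L B (a ` {..i})) (a ` {..i})" using part_of_basis_free[OF V] by metis
    then show ?thesis by (rule ff_imp_part_of_basis[OF V init])
  qed
  then have "part_of_basis L V ?N ((h \<circ> a) ` {..i})" for i
    using part_of_basis_iso[OF V i] by (metis image_comp)
  moreover have "inj (h \<circ> a)"
    using a(1) h(1) aB by (auto simp: emb_def intro: comp_inj_on inj_on_subset)
  ultimately have "part_of_basis L V ?N (range (h \<circ> a))"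
    using range_part_of_basis[of ?N "h \<circ> a"] AEC_mem(1)[OF aec h(2)] h(2) B(2) by simp
  then have "part_of_basis L V B (inv_into (carrier B) h ` range (h \<circ> a))"
    using part_of_basis_iso[OF V iso_inv[OF i]] by blast
  moreover have "inv_into (carrier B) h ` range (h \<circ> a) = range a"
  proof -
    have "inv_into (carrier B) h (h (a m)) = a m" for m
      using h(1) aB by (auto simp: emb_def intro: inv_into_f_f)
    then show ?thesis by (simp add: image_comp comp_def)
  qed
  ultimately have "part_of_basis L V B (range a)" by simp
  then have "ff L V (gen L B (range a)) B" by (rule part_of_basis_imp_ff[OF V])
  then have ffAB: "ff L V A B" using gen_least_eq[OF AB free_onD(3,2)[OF a(2)]] by simp
  \<comment> \<open>The subalgebra generated by the empty set is free of rank 0. With it as second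
    factor the coprojection of \<open>B\<close> is the identity, so the image of \<open>A\<close> is
    \<open>A\<close> itself.\<close>
  have "part_of_basis L V B {}" using B(1) by (auto simp: part_of_basis_def free_inf_def)
  then have "gen L B {} \<in> free_algs L V" using part_of_basis_free[OF V] by (auto simp: free_algs_def)
  then have "\<not> ff L V (img L B id A) B" using noff coproduct_gen_empty[OF V BV] by blast
  then show False using ffAB induced_substr[OF AB] by simp
qed

end
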